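(* Let $k\geq 1$ be an integer, $\rho>0$, and $\kappa=-1/\rho^2$. For $\lambda\in\mathbb{C}$ let $\varphi_\lambda$ denote the unique radial eigenfunction of the hyperbolic Laplacian on the $(k+1)$-dimensional hyperbolic space of constant sectional curvature $\kappa$ with eigenvalue $\lambda$ and $\varphi_\lambda(0)=1$. Let $$\Omega(0)=\left\{\varphi_\mu \;\middle|\; \varphi_\mu(0)=1,\ \mu\in\mathbb{R}\ \text{and}\ \mu\leq\frac{-\kappa k^2}{4}\right\}.$$ Let $r_0\in(0,\infty)$. Then the value at $r_0$ determines a radial eigenfunction in $\Omega(0)$ uniquely: if $\varphi_\mu,\varphi_{\mu'}\in\Omega(0)$ and $\varphi_\mu(r_0)=\varphi_{\mu'}(r_0)$, then $\mu=\mu'$ and $\varphi_\mu(r)=\varphi_{\mu'}(r)$ for all $r\geq 0$. Moreover, for every $\varphi_\mu\in\Omega(0)$ there are infinitely many radial eigenfunctions $\varphi_\nu\notin\Omega(0)$ (with $\nu\in\mathbb{C}$ and $\varphi_\nu(0)=1$) such that $\varphi_\nu(r_0)=\varphi_\mu(r_0)$.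
   Context: The variable $r$ is the hyperbolic distance to the origin. A radial eigenfunction with eigenvalue $\lambda\in\mathbb{C}$ is a complex-valued twice continuously differentiable function on the hyperbolic space depending only on $r$, regarded as a function $\varphi:[0,\infty)\to\mathbb{C}$ (in particular continuous at $r=0$), satisfying $\varphi''(r)+\frac{k}{\rho}\coth\left(\frac{r}{\rho}\right)\varphi'(r)+\lambda\varphi(r)=0$ for $r>0$. For each $\lambda\in\mathbb{C}$ there is exactly one such function with $\varphi(0)=1$. *)

theory Defs
  imports "HOL-Analysis.Analysis"
begin

text \<open>
  The hyperbolic space of dimension \<^term>\<open>DIM('a::euclidean_space)\<close> and constant sectional
  curvature \<open>- 1 / \<rho>\<^sup>2\<close> is represented by the Poincare ball model: the unit ball \<open>ball 0 1\<close> of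
  \<open>'a\<close> with the Riemannian metric \<open>4 \<rho>\<^sup>2 |dx|\<^sup>2 / (1 - |x|\<^sup>2)\<^sup>2\<close>. Integrating \<open>2 \<rho> dt / (1 - t\<^sup>2)\<close>
  along a ray gives the distance to the origin. As the model is a single global chart, being
  twice continuously differentiable on the hyperbolic space is being so on the ball.
\<close>

definition hyp_radius :: "real \<Rightarrow> 'a::euclidean_space \<Rightarrow> real" where
  "hyp_radius \<rho> x = 2 * \<rho> * artanh (norm x)"

definition twice_continuously_differentiable_on ::
    "('a::real_normed_vector \<Rightarrow> 'b::real_normed_vector) \<Rightarrow> 'a set \<Rightarrow> bool"
    (infix \<open>twice'_continuously'_differentiable'_on\<close> 50) where
  "f twice_continuously_differentiable_on S \<longleftrightarrow>
    (\<exists>(f' :: 'a \<Rightarrow> 'a \<Rightarrow>\<^sub>L 'b) (f'' :: 'a \<Rightarrow> 'a \<Rightarrow>\<^sub>L ('a \<Rightarrow>\<^sub>L 'b)).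
      (\<forall>x\<in>S. (f has_derivative blinfun_apply (f' x)) (at x within S)) \<and>
      (\<forall>x\<in>S. (f' has_derivative blinfun_apply (f'' x)) (at x within S)) \<and>
      continuous_on S f'')"

text \<open>
  A radial function is regarded as a function \<open>\<phi>\<close> on \<open>{0..}\<close>. Requiring \<open>\<phi> \<in> extensional {0..}\<close>
  fixes its irrelevant values at negative arguments, so that equality of such \<open>\<phi>\<close> is equality
  on \<open>{0..}\<close>. With \<open>k = DIM('a) - 1\<close>, the equation is
  \<open>\<phi>'' + (k / \<rho>) coth (r / \<rho>) \<phi>' + \<mu> \<phi> = 0\<close>, i.e. \<open>\<Delta> f + \<mu> f = 0\<close> for
  \<open>f = \<phi> \<circ> hyp_radius \<rho>\<close>.
\<close>

definition radial_eigenfunction ::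
    "'a::euclidean_space itself \<Rightarrow> real \<Rightarrow> complex \<Rightarrow> (real \<Rightarrow> complex) \<Rightarrow> bool" where
  "radial_eigenfunction _ \<rho> \<mu> \<phi> \<longleftrightarrow>
    \<phi> \<in> extensional {0..} \<and>
    (\<lambda>x::'a. \<phi> (hyp_radius \<rho> x)) twice_continuously_differentiable_on ball 0 1 \<and>
    (\<exists>\<phi>' \<phi>''. \<forall>r>0.
      (\<phi> has_vector_derivative \<phi>' r) (at r) \<and>
      (\<phi>' has_vector_derivative \<phi>'' r) (at r) \<and>
      \<phi>'' r + of_real (real (DIM('a) - 1) / \<rho> * (cosh (r / \<rho>) / sinh (r / \<rho>))) * \<phi>' r
        + \<mu> * \<phi> r = 0)"

definition radial_phi ::
    "'a::euclidean_space itself \<Rightarrow> real \<Rightarrow> complex \<Rightarrow> real \<Rightarrow> complex" where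
  "radial_phi S \<rho> \<mu> = (THE \<phi>. radial_eigenfunction S \<rho> \<mu> \<phi> \<and> \<phi> 0 = 1)"

end

theory Submission
  imports Defs "HOL-Complex_Analysis.Complex_Analysis"
begin

text \<open>
  Put \<open>P(r) = sinh(r/\<rho>)^k\<close>, so that the equation reads \<open>(P \<phi>')' = - \<mu> P \<phi>\<close>. Iterating
  \<open>T g(r) = \<integral>\<^sub>0\<^sup>r P(t)^(-1) \<integral>\<^sub>0\<^sup>t P(s) g(s) ds dt\<close> on the constant 1 gives positive functions
  \<open>a\<^sub>n \<le> r^(2 n) / (2 n)!\<close>, and the eigenfunction is the power series
  \<open>\<phi>\<^sub>\<mu>(r) = \<Sum>\<^sub>n a\<^sub>n(r) (- \<mu>)^n\<close> in \<open>\<mu>\<close>.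

  For real \<open>\<mu> \<le> k\<^sup>2 / (4 \<rho>\<^sup>2)\<close> the function \<open>exp(- k r / (2 \<rho>))\<close> is a positive supersolution, so Sturm
  comparison yields \<open>\<phi>\<^sub>\<mu> > 0\<close>. Comparing two such eigenfunctions with each other
  shows that \<open>\<phi>\<^sub>\<mu>(r\<^sub>0)\<close> is strictly decreasing in \<open>\<mu>\<close> there.

  For fixed \<open>r\<^sub>0\<close> the entire function \<open>\<mu> \<mapsto> \<phi>\<^sub>\<mu>(r\<^sub>0)\<close> has order at most 1/2 and is not a polynomial, hence
  takes every value infinitely often; at most one of these parameters belongs to \<open>\<Omega>(0)\<close>.
\<close>

section \<open>Entire functions of order at most 1/2\<close>

text \<open>The coefficient \<open>coth\<close> blows up at 0, so ordinary initial value theory does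
  not apply there, and the definite description in \<open>radial_phi\<close> says something only
  once existence and uniqueness are established. For existence the series must be twice continuously
  differentiable on the ball, centre included, which comes down to the limit of
  \<open>\<phi>' / sinh\<close> at 0. Conversely, smoothness on the ball keeps
  \<open>\<phi>'\<close> bounded near 0 and so excludes the second solution, whose derivative
  behaves like \<open>1 / P\<close>. The same limit reveals \<open>\<mu>\<close>, so distinct
  parameters give distinct functions; this is what turns membership in \<open>\<Omega>0\<close>, a
  set of functions, and the infinitude of a set of functions into statements about parameters. The
  order 1/2 leaves no room for exceptional values: a zero-free function of this growth is
  \<open>exp g\<close> with \<open>Re g\<close> bounded above by a multiple of
  \<open>sqrt (norm z)\<close> plus a constant, too little for a nonconstant entire
  \<open>g\<close>. Positivity of all coefficients \<open>a n\<close> excludes polynomials.\<close>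

lemma entire_constant_if_Re_le_sqrt:
  assumes hol: "g holomorphic_on UNIV"
    and bound: "\<And>z. Re (g z) \<le> A + D * sqrt (norm z)" and "D \<ge> 0"
  shows "g z = g 0"
proof (cases "z = 0")
  case False
  define h where "h w = g w - g 0" for w
  \<comment> \<open>The summand 1 makes the bound \<open>Re (h w) < M R\<close> strict, so that the
    denominator of \<open>q\<close> below cannot vanish.\<close>
  define M where "M R = \<bar>A\<bar> + norm (g 0) + 1 + D * sqrt R" for R
  \<comment> \<open>Borel-Caratheodory: an upper bound for the real part on a disc controls the
    modulus well inside it. Since \<open>M R\<close> grows only like \<open>sqrt R\<close>, the
    right-hand side tends to 0.\<close>
  have "norm (h z) \<le> 4 * M R * norm z / R" if R: "R \<ge> 2 * norm z" for R
  proof -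
    have "R > 0" using False R by (smt (verit) zero_less_norm_iff)
    have M: "M R > 0" using \<open>D \<ge> 0\<close> \<open>R > 0\<close> by (simp add: M_def add_nonneg_pos add_pos_nonneg)
    have Re_h: "Re (h w) < M R" if "norm w \<le> R" for w
    proof -
      have "D * sqrt (norm w) \<le> D * sqrt R"
        using that \<open>D \<ge> 0\<close> by (intro mult_left_mono) auto
      then show ?thesis
        using bound[of w] abs_Re_le_cmod[of "g 0"] by (simp add: h_def M_def)
    qed
    have lt: "norm (h w) < norm (2 * of_real (M R) - h w)" if "norm w \<le> R" for w
    proof (rule power2_less_imp_less)
      have "0 < 4 * M R * (M R - Re (h w))"
        using M Re_h[OF that] by simp
      then show "(norm (h w))\<^sup>2 < (norm (2 * of_real (M R) - h w))\<^sup>2"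
        by (simp add: cmod_power2) (simp add: power2_eq_square algebra_simps)
    qed simp
    \<comment> \<open>Points with real part below \<open>M R\<close> are nearer to 0 than to
      \<open>2 * M R\<close>, so this Moebius map sends the half plane into the unit disc and fixes
      0, as the Schwarz lemma demands.\<close>
    define q where "q w = h (of_real R * w) / (2 * of_real (M R) - h (of_real R * w))" for w
    have small: "norm (of_real R * w) \<le> R" if "norm w < 1" for w :: complex
      using that \<open>R > 0\<close> by (simp add: norm_mult)
    have "q holomorphic_on ball 0 1"
      unfolding q_def h_def
    proof (intro holomorphic_intros holomorphic_on_compose_gen[OF _ hol, unfolded o_def])
      fix w :: complex
      assume "w \<in> ball 0 1"
      then show "2 * of_real (M R) - (g (of_real R * w) - g 0) \<noteq> 0"
        using lt[OF small, of w] unfolding h_def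
        by (metis dist_0_norm mem_ball norm_not_less_zero norm_zero)
    qed auto
    moreover have "q 0 = 0" by (simp add: q_def h_def)
    moreover have "norm (q w) < 1" if "norm w < 1" for w
      using lt[OF small[OF that]] norm_not_less_zero[of "h (of_real R * w)"]
      by (auto simp: q_def norm_divide divide_less_eq_1)
    moreover have z1: "norm (z / of_real R) < 1"
      using False R \<open>R > 0\<close> by (simp add: norm_divide)
    ultimately have "norm (q (z / of_real R)) \<le> norm (z / of_real R)"
      by (rule Schwarz_Lemma(1))
    then have "norm (h z) / norm (2 * of_real (M R) - h z) \<le> norm z / R"
      using \<open>R > 0\<close> by (simp add: q_def norm_divide)
    moreover have "norm (2 * of_real (M R) - h z) > 0"
      using lt[of z] R by (smt (verit) norm_ge_zero)
    ultimately have "norm (h z) \<le> norm z / R * norm (2 * of_real (M R) - h z)"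
      by (simp add: pos_divide_le_eq)
    also have "\<dots> \<le> norm z / R * (2 * M R + norm (h z))"
      using \<open>R > 0\<close> M norm_triangle_ineq4[of "2 * of_real (M R)" "h z"]
      by (intro mult_left_mono) (auto simp: norm_mult)
    \<comment> \<open>Since \<open>R \<ge> 2 * norm z\<close>, half of \<open>norm (h z)\<close> can
      be absorbed on the left, which doubles the factor 2 to 4.\<close>
    also have "\<dots> \<le> norm z / R * (2 * M R) + 1 / 2 * norm (h z)"
      unfolding distrib_left using \<open>R > 0\<close> R
      by (intro add_left_mono mult_right_mono) (auto simp: field_simps)
    finally show ?thesis by (simp add: field_simps)
  qed
  then have "eventually (\<lambda>R. norm (h z) \<le> 4 * M R * norm z / R) at_top"
    by (rule eventually_at_top_linorderI)
  moreover have "((\<lambda>R. 4 * M R * norm z / R) \<longlongrightarrow> 0) at_top"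
    unfolding M_def by real_asymp
  ultimately have "norm (h z) \<le> 0"
    by (intro tendsto_lowerbound[of _ 0 at_top]) auto
  then show ?thesis by (simp add: h_def)
qed simp

text \<open>The local factor near \<open>a\<close> and the quotient away from \<open>a\<close> agree
  on the overlap of two open sets covering the plane, so they glue to an entire function. The point
  \<open>b\<close> rules out the zero function, which has no finite order of vanishing.\<close>

lemma entire_divide_zero:
  assumes hol: "f holomorphic_on UNIV" and "f a = 0" and nz: "f b \<noteq> 0"
  obtains g n where "g holomorphic_on UNIV" "\<And>z. f z = (z - a) ^ n * g z" "g a \<noteq> 0"
proof -
  have "\<not> f constant_on UNIV"
    using assms unfolding constant_on_def by (metis UNIV_I)
  then obtain g0 r n where "0 < r" and g0: "g0 holomorphic_on ball a r"
      and fg0: "\<And>w. w \<in> ball a r \<Longrightarrow> f w = (w - a) ^ n * g0 w"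
      and g0_nz: "\<And>w. w \<in> ball a r \<Longrightarrow> g0 w \<noteq> 0"
    using holomorphic_factor_zero_nonconstant[OF hol open_UNIV connected_UNIV UNIV_I \<open>f a = 0\<close>]
    by metis
  define g where "g z = (if z = a then g0 a else f z / (z - a) ^ n)" for z
  have eq: "g z = g0 z" if "z \<in> ball a r" for z
    using fg0[OF that] by (auto simp: g_def)
  have "g holomorphic_on ball a r"
    using g0 by (rule holomorphic_transform) (simp add: eq)
  moreover have "g holomorphic_on - {a}"
  proof (rule holomorphic_transform)
    show "(\<lambda>z. f z / (z - a) ^ n) holomorphic_on - {a}"
      by (intro holomorphic_intros holomorphic_on_subset[OF hol]) auto
  qed (auto simp: g_def)
  ultimately have "g holomorphic_on (ball a r \<union> - {a})"
    by (intro holomorphic_on_Un) auto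
  moreover have "ball a r \<union> - {a} = UNIV" using \<open>0 < r\<close> by auto
  ultimately have "g holomorphic_on UNIV" by simp
  moreover have "f z = (z - a) ^ n * g z" for z
    using fg0[of a] \<open>0 < r\<close> by (cases "z = a") (auto simp: g_def)
  moreover have "g a \<noteq> 0" using g0_nz[of a] \<open>0 < r\<close> by (simp add: g_def)
  ultimately show ?thesis by (rule that)
qed

text \<open>Hadamard's factorization in the only case needed: order at most 1/2, so that the
  zero-free factor is constant.\<close>

lemma entire_finite_zeros_imp_polynomial:
  fixes f :: "complex \<Rightarrow> complex"
  assumes "f holomorphic_on UNIV" "\<And>z. norm (f z) \<le> C * exp (D * sqrt (norm z))" "D \<ge> 0"
    and "finite {z. f z = 0}"
  shows "\<exists>p. f = poly p"
  using assms
proof (induction "card {z. f z = 0}" arbitrary: f C)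
  case 0
  then have nz: "f z \<noteq> 0" for z by auto
  \<comment> \<open>On the plane a zero-free function has a holomorphic logarithm \<open>g\<close>,
    and the growth bound for \<open>f\<close> becomes a one-sided bound for
    \<open>Re g\<close>.\<close>
  have "simply_connected (UNIV :: complex set)" by (simp add: convex_imp_simply_connected)
  then obtain g where g: "g holomorphic_on UNIV" "\<And>z. f z = exp (g z)"
    using simply_connected_eq_holomorphic_log[OF open_UNIV] 0 nz by (metis UNIV_I)
  have "0 < norm (f 0)" using nz by simp
  also have "\<dots> \<le> C" using 0(3)[of 0] by simp
  finally have "C > 0" .
  have "g z = g 0" for z
  proof (rule entire_constant_if_Re_le_sqrt[OF g(1)])
    fix z
    have "exp (Re (g z)) \<le> C * exp (D * sqrt (norm z))"
      using 0(3)[of z] g(2)[of z] by simp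
    also have "\<dots> = exp (ln C + D * sqrt (norm z))"
      using \<open>C > 0\<close> by (simp add: exp_add)
    finally show "Re (g z) \<le> ln C + D * sqrt (norm z)" by simp
  qed (use 0 in simp)
  then have "f = poly [:exp (g 0):]" using g(2) by (intro ext) (metis poly_pCons poly_0 mult_zero_right add_0_right)
  then show ?case ..
next
  case (Suc m)
  from Suc.hyps(2) obtain a where a: "f a = 0"
    by (metis (mono_tags, lifting) Collect_empty_eq card.empty nat.distinct(1))
  have "\<exists>b. f b \<noteq> 0"
  proof (rule ccontr)
    assume "\<not> ?thesis"
    with Suc.prems(4) show False using infinite_UNIV_char_0[where 'a=complex] by simp
  qed
  then obtain b where b: "f b \<noteq> 0" ..
  obtain g n where g: "g holomorphic_on UNIV" "\<And>z. f z = (z - a) ^ n * g z" "g a \<noteq> 0"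
    using entire_divide_zero[OF Suc.prems(1) a b] by metis
  \<comment> \<open>The full multiplicity at \<open>a\<close> is divided out at once, so the number
    of distinct zeros drops by exactly one.\<close>
  have zeros: "{z. g z = 0} = {z. f z = 0} - {a}" (is "?Zg = _")
    using g(2,3) a by auto
  have card: "m = card ?Zg"
    using Suc.hyps(2) Suc.prems(4) a unfolding zeros by (simp add: card_Diff_singleton_if)
  have "continuous_on (cball a 1) g"
    using g(1) holomorphic_on_imp_continuous_on continuous_on_subset by blast
  then have "bounded (g ` cball a 1)"
    by (simp add: compact_continuous_image compact_imp_bounded)
  then obtain B where B: "\<And>z. z \<in> cball a 1 \<Longrightarrow> norm (g z) \<le> B" "B > 0"
    unfolding bounded_pos by blast
  \<comment> \<open>Outside the unit disc around \<open>a\<close> dividing by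
    \<open>(z - a) ^ n\<close> cannot increase the modulus; inside, compactness supplies
    \<open>B\<close>. Only the leading constant changes, so the induction can keep \<open>D\<close>
    fixed.\<close>
  have "norm (g z) \<le> (B + \<bar>C\<bar>) * exp (D * sqrt (norm z))" for z
  proof (cases "z \<in> cball a 1")
    case True
    have "norm (g z) \<le> (B + \<bar>C\<bar>) * 1" using B True by (simp add: add_increasing2)
    also have "\<dots> \<le> (B + \<bar>C\<bar>) * exp (D * sqrt (norm z))"
      using B(2) \<open>D \<ge> 0\<close> by (intro mult_left_mono) auto
    finally show ?thesis .
  next
    case False
    then have "1 \<le> norm (z - a)" by (simp add: dist_norm norm_minus_commute)
    then have "norm (g z) \<le> norm (z - a) ^ n * norm (g z)"
      by (simp add: mult_le_cancel_right1)
    also have "\<dots> = norm (f z)" by (simp add: g(2) norm_mult norm_power)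
    also have "\<dots> \<le> C * exp (D * sqrt (norm z))" using Suc.prems by blast
    also have "\<dots> \<le> (B + \<bar>C\<bar>) * exp (D * sqrt (norm z))"
      using B(2) by (intro mult_right_mono) auto
    finally show ?thesis .
  qed
  moreover have "finite ?Zg" using Suc.prems(4) zeros by simp
  ultimately obtain p where p: "g = poly p"
    using Suc.hyps(1)[OF card g(1)] \<open>D \<ge> 0\<close> by blast
  have "f z = poly ([:-a, 1:] ^ n * p) z" for z
    by (simp add: g(2) p)
  then show ?case by blast
qed

lemma norm_poly_le:
  fixes p :: "complex poly"
  obtains K where "\<And>z. norm z \<ge> 1 \<Longrightarrow> norm (poly p z) \<le> K * norm z ^ degree p"
proof -
  have "norm (poly p z) \<le> (\<Sum>i\<le>degree p. norm (coeff p i)) * norm z ^ degree p"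
    if "norm z \<ge> 1" for z
  proof -
    have "norm (poly p z) \<le> (\<Sum>i\<le>degree p. norm (coeff p i * z ^ i))"
      unfolding poly_altdef by (rule norm_sum)
    also have "\<dots> \<le> (\<Sum>i\<le>degree p. norm (coeff p i) * norm z ^ degree p)"
      using that by (intro sum_mono) (auto simp: norm_mult norm_power intro!: mult_left_mono power_increasing)
    finally show ?thesis by (simp add: sum_distrib_right)
  qed
  then show ?thesis using that by blast
qed


section \<open>Value distribution of power series of order at most 1/2\<close>

lemma sums_even_exp_le:
  fixes x :: real
  assumes "x \<ge> 0"
  shows "summable (\<lambda>n. x ^ (2 * n) / fact (2 * n))"
    and "(\<Sum>n. x ^ (2 * n) / fact (2 * n)) \<le> exp x"
proof -
  have "(\<lambda>n. if even n then x ^ n /\<^sub>R fact n else 0) sums cosh x"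
    by (rule cosh_converges)
  moreover have "strict_mono (\<lambda>n::nat. 2 * n)" by (simp add: strict_mono_def)
  ultimately have "(\<lambda>n. x ^ (2 * n) / fact (2 * n)) sums cosh x"
    using sums_mono_reindex[of "\<lambda>n::nat. 2 * n" "\<lambda>n. if even n then x ^ n /\<^sub>R fact n else 0"]
    by (force simp: divide_inverse mult.commute[of _ "inverse _"] elim!: evenE)
  moreover have "cosh x \<le> exp x"
    using assms by (simp add: cosh_def)
  ultimately show "summable (\<lambda>n. x ^ (2 * n) / fact (2 * n))"
    "(\<Sum>n. x ^ (2 * n) / fact (2 * n)) \<le> exp x"
    by (auto simp: sums_iff)
qed

text \<open>With \<open>t = r * sqrt (norm z)\<close> the series is dominated by that of
  \<open>cosh t\<close>, hence by \<open>exp t\<close>. If a value were taken only finitely often,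
  the function would be a polynomial; but for negative \<open>z\<close> all terms are positive, and
  a single term outgrows any polynomial of lower degree.\<close>

lemma powser_order_half_takes_values_infinitely_often:
  fixes a :: "nat \<Rightarrow> real" and c :: complex
  assumes pos: "\<And>n. a n > 0" and le: "\<And>n. a n \<le> r ^ (2 * n) / fact (2 * n)" and "r \<ge> 0"
  shows "infinite {z. (\<Sum>n. of_real (a n) * (- z) ^ n) = c}"
proof
  define f where "f z = (\<Sum>n. of_real (a n) * (- z) ^ n)" for z :: complex
  have term_le: "norm (of_real (a n) * (- z) ^ n) \<le> (r * sqrt (norm z)) ^ (2 * n) / fact (2 * n)"
    for n and z :: complex
  proof -
    have "norm (of_real (a n) * (- z) ^ n) = a n * norm z ^ n"
      using pos[of n] by (simp add: norm_mult norm_power)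
    also have "\<dots> \<le> r ^ (2 * n) / fact (2 * n) * norm z ^ n"
      using le by (intro mult_right_mono) auto
    also have "\<dots> = (r * sqrt (norm z)) ^ (2 * n) / fact (2 * n)"
      by (simp add: power_mult_distrib power_mult)
    finally show ?thesis .
  qed
  have norm_summable: "summable (\<lambda>n. norm (of_real (a n) * (- z) ^ n))" for z :: complex
  proof (rule summable_comparison_test')
    show "summable (\<lambda>n. (r * sqrt (norm z)) ^ (2 * n) / fact (2 * n))"
      using \<open>r \<ge> 0\<close> by (intro sums_even_exp_le) simp
  qed (use term_le in simp)
  then have summable: "summable (\<lambda>n. of_real (a n) * (- z) ^ n)" for z :: complex
    by (rule summable_norm_cancel)
  have bound: "norm (f z) \<le> exp (r * sqrt (norm z))" for z
  proof -
    have "norm (f z) \<le> (\<Sum>n. norm (of_real (a n) * (- z) ^ n))"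
      unfolding f_def by (rule summable_norm[OF norm_summable])
    also have "\<dots> \<le> (\<Sum>n. (r * sqrt (norm z)) ^ (2 * n) / fact (2 * n))"
      using \<open>r \<ge> 0\<close> by (intro suminf_le term_le norm_summable sums_even_exp_le) auto
    also have "\<dots> \<le> exp (r * sqrt (norm z))"
      using \<open>r \<ge> 0\<close> by (intro sums_even_exp_le) auto
    finally show ?thesis .
  qed
  \<comment> \<open>The sign is removed first because termwise differentiation is applied to an
    ordinary power series in \<open>z\<close>.\<close>
  have "(\<lambda>z. f (- z)) holomorphic_on UNIV"
  proof (subst holomorphic_on_open[OF open_UNIV], safe)
    fix z :: complex
    have "(\<lambda>n. of_real (a n) * z ^ n) sums f (- z)" for z
      using summable[of "- z"] by (simp add: f_def sums_iff)
    then show "\<exists>f'. ((\<lambda>z. f (- z)) has_field_derivative f') (at z)"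
      using termdiffs_strong_converges_everywhere[of "\<lambda>n. of_real (a n)" z]
      by (metis (no_types, lifting) ext sums_iff)
  qed
  then have "(\<lambda>z. f (- (- z))) holomorphic_on UNIV"
    by (intro holomorphic_on_compose_gen[of uminus _ "\<lambda>z. f (- z)" UNIV, unfolded o_def] holomorphic_intros) auto
  then have "(\<lambda>z. f z - c) holomorphic_on UNIV"
    by (intro holomorphic_intros) simp
  moreover have "norm (f z - c) \<le> (1 + norm c) * exp (r * sqrt (norm z))" for z
  proof -
    have "norm (f z - c) \<le> exp (r * sqrt (norm z)) + norm c * 1"
      using norm_triangle_ineq4[of "f z" c] bound[of z] by simp
    also have "\<dots> \<le> exp (r * sqrt (norm z)) + norm c * exp (r * sqrt (norm z))"
      using \<open>r \<ge> 0\<close> by (intro add_left_mono mult_left_mono) auto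
    finally show ?thesis by (simp add: algebra_simps)
  qed
  moreover assume "finite {z. (\<Sum>n. of_real (a n) * (- z) ^ n) = c}"
  then have "finite {z. f z - c = 0}" by (simp add: f_def)
  ultimately obtain p where p: "(\<lambda>z. f z - c) = poly p"
    using entire_finite_zeros_imp_polynomial[OF _ _ \<open>r \<ge> 0\<close>] by blast
  obtain K where K: "\<And>z. norm z \<ge> 1 \<Longrightarrow> norm (poly p z) \<le> K * norm z ^ degree p"
    using norm_poly_le by blast
  \<comment> \<open>One degree above \<open>p\<close> suffices: after division by
    \<open>x ^ degree p\<close> the term of index \<open>?N\<close> is still linear in
    \<open>x\<close>, while the rest is bounded.\<close>
  let ?N = "Suc (degree p)"
  have "a ?N * x \<le> K + norm c" if "x \<ge> 1" for x :: real
  proof -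
    have f_eq: "f (- of_real x) = of_real (\<Sum>n. a n * x ^ n)"
      and sm: "summable (\<lambda>n. a n * x ^ n)"
    proof -
      have "summable (\<lambda>n. complex_of_real (a n * x ^ n))"
        using summable[of "- of_real x"] by simp
      then show "summable (\<lambda>n. a n * x ^ n)" by (simp only: summable_complex_of_real)
      then show "f (- of_real x) = of_real (\<Sum>n. a n * x ^ n)"
        by (simp add: f_def suminf_of_real)
    qed
    have "a ?N * x ^ ?N = (\<Sum>n\<in>{?N}. a n * x ^ n)" by simp
    also have "\<dots> \<le> (\<Sum>n. a n * x ^ n)"
      using that by (intro sum_le_suminf[OF sm]) (auto intro!: mult_nonneg_nonneg less_imp_le[OF pos])
    also have "\<dots> \<le> norm (f (- of_real x))"
      by (simp add: f_eq)
    also have "\<dots> = norm (poly p (- of_real x) + c)"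
      using fun_cong[OF p, of "- of_real x"] by (metis diff_add_cancel)
    also have "\<dots> \<le> K * x ^ degree p + norm c * 1"
      using norm_triangle_ineq[of "poly p (- of_real x)" c] K[of "- of_real x"] that by simp
    also have "\<dots> \<le> K * x ^ degree p + norm c * x ^ degree p"
      using that by (intro add_left_mono mult_left_mono) auto
    finally have "(a ?N * x) * x ^ degree p \<le> (K + norm c) * x ^ degree p"
      by (simp add: algebra_simps)
    then show ?thesis using that by simp
  qed
  note le = this
  \<comment> \<open>Large enough that \<open>a ?N * x\<close> exceeds the claimed bound by 1, and at
    least 1 so that the bound applies.\<close>
  define x where "x = max 1 ((K + norm c + 1) / a ?N)"
  have "K + norm c + 1 = a ?N * ((K + norm c + 1) / a ?N)"
    using pos[of ?N] by simp
  also have "\<dots> \<le> a ?N * x"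
    using pos[of ?N] by (intro mult_left_mono) (auto simp: x_def)
  finally show False
    using le[of x] by (simp add: x_def)
qed

section \<open>Iterated integrals\<close>

lemma DERIV_le_imp_le:
  fixes f g :: "real \<Rightarrow> real"
  assumes "a \<le> b" and cont: "continuous_on {a..b} f" "continuous_on {a..b} g"
    and f: "\<And>x. a < x \<Longrightarrow> x < b \<Longrightarrow> (f has_real_derivative f' x) (at x)"
    and g: "\<And>x. a < x \<Longrightarrow> x < b \<Longrightarrow> (g has_real_derivative g' x) (at x)"
    and le: "\<And>x. a < x \<Longrightarrow> x < b \<Longrightarrow> f' x \<le> g' x" and "f a \<le> g a"
  shows "f b \<le> g b"
proof -
  have "g a - f a \<le> g b - f b"
  proof (rule DERIV_nonneg_imp_increasing_open[where f = "\<lambda>x. g x - f x"])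
    fix x assume "a < x" "x < b"
    then show "\<exists>y. ((\<lambda>x. g x - f x) has_real_derivative y) (at x) \<and> 0 \<le> y"
      using f g le by (intro exI[of _ "g' x - f' x"]) (auto intro!: derivative_intros)
  qed (use assms in \<open>auto intro!: continuous_intros\<close>)
  then show ?thesis using \<open>f a \<le> g a\<close> by simp
qed

lemma integral_from_0_has_real_derivative:
  fixes h :: "real \<Rightarrow> real"
  assumes "continuous_on {0..} h" "r > 0"
  shows "((\<lambda>r. integral {0..r} h) has_real_derivative h r) (at r)"
proof -
  have "((\<lambda>r. integral {0..r} h) has_real_derivative h r) (at r within {0..r+1})"
    using assms by (intro integral_has_real_derivative continuous_on_subset[OF assms(1)]) auto
  moreover have "at r within {0..r+1} = at r"
    using assms(2) by (intro at_within_interior) simp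
  ultimately show ?thesis by simp
qed

lemma integral_from_0_continuous_on:
  fixes h :: "real \<Rightarrow> real"
  assumes "continuous_on {0..} h"
  shows "continuous_on {0..r} (\<lambda>r. integral {0..r} h)"
  by (intro indefinite_integral_continuous_1 integrable_continuous_real
      continuous_on_subset[OF assms]) auto

lemma integral_from_0_pos:
  fixes h :: "real \<Rightarrow> real"
  assumes h: "continuous_on {0..} h" "\<And>t. t > 0 \<Longrightarrow> h t > 0" and "r > 0"
  shows "integral {0..r} h > 0"
proof -
  have "integral {0..0} h < integral {0..r} h"
    using h \<open>r > 0\<close>
    by (intro DERIV_pos_imp_increasing_open[where f = "\<lambda>r. integral {0..r} h"]
        integral_from_0_continuous_on) (auto intro: integral_from_0_has_real_derivative)
  then show ?thesis by simp
qed

lemma integral_from_0_le: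
  fixes h :: "real \<Rightarrow> real"
  assumes h: "continuous_on {0..} h" and "r \<ge> 0"
    and le: "\<And>t. 0 < t \<Longrightarrow> t < r \<Longrightarrow> h t \<le> C * (t ^ n / fact n)"
  shows "integral {0..r} h \<le> C * (r ^ Suc n / fact (Suc n))"
proof (rule DERIV_le_imp_le[where f = "\<lambda>r. integral {0..r} h" and f' = h
      and g = "\<lambda>t. C * (t ^ Suc n / fact (Suc n))" and g' = "\<lambda>t. C * (t ^ n / fact n)" and a = 0])
  fix t :: real
  show "((\<lambda>t. C * (t ^ Suc n / fact (Suc n))) has_real_derivative C * (t ^ n / fact n)) (at t)"
    using DERIV_cmult[OF DERIV_cdivide[OF DERIV_pow[of "Suc n" t UNIV], of "fact (Suc n)"], of C]
    by (simp del: of_nat_Suc)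
qed (use assms in \<open>auto intro!: continuous_intros integral_from_0_continuous_on
      integral_from_0_has_real_derivative\<close>)

lemma continuous_on_half_lineI:
  fixes f :: "real \<Rightarrow> 'b::topological_space"
  assumes "\<And>R. R > 0 \<Longrightarrow> continuous_on {0..R} f"
  shows "continuous_on {0..} f"
  unfolding continuous_on_eq_continuous_within
proof
  fix r :: real assume "r \<in> {0..}"
  then have "continuous (at r within {0..r + 1}) f"
    using assms[of "r + 1"] by (auto simp: continuous_on_eq_continuous_within)
  moreover have "at r within {0..r + 1} = at r within {0..}"
    by (rule at_within_nhd[of _ "{..<r + 1}"]) auto
  ultimately show "continuous (at r within {0..}) f" by simp
qed

section \<open>The flux operator and the iterates\<close>

locale hyperbolic =
  fixes k :: nat and \<rho> :: real
  assumes rho_pos: "\<rho> > 0"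
begin

definition S :: "real \<Rightarrow> real" where "S r = sinh (r / \<rho>)"

text \<open>In dimension \<open>k + 1\<close> this is, up to a constant factor, the area of the
  geodesic sphere of radius \<open>r\<close>; it is also the integrating factor of the
  equation.\<close>

definition P :: "real \<Rightarrow> real" where "P r = S r ^ k"

lemma S_pos: "r > 0 \<Longrightarrow> S r > 0"
  and S_nonneg: "r \<ge> 0 \<Longrightarrow> S r \<ge> 0"
  and S_0 [simp]: "S 0 = 0"
  and S_mono: "r \<le> s \<Longrightarrow> S r \<le> S s"
  using rho_pos by (simp_all add: S_def divide_right_mono)

lemma continuous_on_S [continuous_intros]: "continuous_on A S"
  unfolding S_def using rho_pos by (intro continuous_intros) auto

lemma S_deriv [derivative_intros]:
  "(S has_real_derivative cosh (r / \<rho>) / \<rho>) (at r)"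
  unfolding S_def[abs_def] using rho_pos by (auto intro!: derivative_eq_intros)

lemma P_pos: "r > 0 \<Longrightarrow> P r > 0"
  and P_nonneg: "r \<ge> 0 \<Longrightarrow> P r \<ge> 0"
  and P_mono: "0 \<le> r \<Longrightarrow> r \<le> s \<Longrightarrow> P r \<le> P s"
  by (simp_all add: P_def S_pos S_nonneg S_mono power_mono)

lemma continuous_on_P [continuous_intros]: "continuous_on A P"
  unfolding P_def by (intro continuous_intros)

definition coth_coeff :: "real \<Rightarrow> real" where
  "coth_coeff r = real k / \<rho> * (cosh (r / \<rho>) / sinh (r / \<rho>))"

lemma P_deriv:
  assumes "r > 0"
  shows "(P has_real_derivative coth_coeff r * P r) (at r)"
proof -
  have "(P has_real_derivative real k * S r ^ (k - 1) * (cosh (r / \<rho>) / \<rho>)) (at r)"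
    unfolding P_def by (rule derivative_eq_intros refl)+ simp
  moreover have "real k * S r ^ (k - 1) * (cosh (r / \<rho>) / \<rho>) = coth_coeff r * P r"
  proof (cases "k = 0")
    case False
    then have "S r ^ k = S r * S r ^ (k - 1)" by (simp add: power_eq_if)
    then show ?thesis
      using S_pos[OF assms] unfolding coth_coeff_def P_def S_def[symmetric] by (simp add: field_simps)
  next
    case True
    then show ?thesis unfolding coth_coeff_def by simp
  qed
  ultimately show ?thesis by simp
qed

text \<open>The solution of \<open>y' + coth_coeff * y = g\<close> that is regular at 0, obtained
  from \<open>(P * y)' = P * g\<close>. At 0 the integral is over a point, so the value is 0, which
  for the iterates is also the limit.\<close>

definition flux :: "(real \<Rightarrow> real) \<Rightarrow> real \<Rightarrow> real" where
  "flux g r = integral {0..r} (\<lambda>t. P t * g t) / P r"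

lemma flux_0 [simp]: "flux g 0 = 0"
  by (simp add: flux_def)

text \<open>For the upper bound, monotonicity of \<open>P\<close> lets the weight
  \<open>P t / P r\<close> be replaced by 1, and what remains is plain integration of a
  power.\<close>

lemma
  assumes cont: "continuous_on {0..} g" and "r > 0"
  shows flux_deriv: "(flux g has_real_derivative g r - coth_coeff r * flux g r) (at r)"
    and flux_pos: "(\<And>t. t > 0 \<Longrightarrow> g t > 0) \<Longrightarrow> flux g r > 0"
    and flux_le: "(\<And>t. t > 0 \<Longrightarrow> g t \<le> t ^ n / fact n) \<Longrightarrow> flux g r \<le> r ^ Suc n / fact (Suc n)"
proof -
  have Pg: "continuous_on {0..} (\<lambda>t. P t * g t)"
    by (intro continuous_intros cont)
  note d = integral_from_0_has_real_derivative[OF Pg \<open>r > 0\<close>]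
  show "(flux g has_real_derivative g r - coth_coeff r * flux g r) (at r)"
    unfolding flux_def
    by (rule derivative_eq_intros d P_deriv[OF \<open>r > 0\<close>])+
      (use P_pos[OF \<open>r > 0\<close>] in \<open>auto simp: field_simps\<close>)
  show "flux g r > 0" if "\<And>t. t > 0 \<Longrightarrow> g t > 0"
    unfolding flux_def using that P_pos \<open>r > 0\<close>
    by (intro divide_pos_pos integral_from_0_pos[OF Pg]) auto
  show "flux g r \<le> r ^ Suc n / fact (Suc n)" if g: "\<And>t. t > 0 \<Longrightarrow> g t \<le> t ^ n / fact n"
  proof -
    have "integral {0..r} (\<lambda>t. P t * g t) \<le> P r * (r ^ Suc n / fact (Suc n))"
    proof (rule integral_from_0_le[OF Pg])
      fix t assume "0 < t" "t < r"
      then have "P t * g t \<le> P t * (t ^ n / fact n)"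
        using g[of t] P_nonneg[of t] by (intro mult_left_mono) auto
      also have "\<dots> \<le> P r * (t ^ n / fact n)"
        using P_mono[of t r] \<open>0 < t\<close> \<open>t < r\<close> by (intro mult_right_mono) auto
      finally show "P t * g t \<le> P r * (t ^ n / fact n)" .
    qed (use \<open>r > 0\<close> in simp)
    then show ?thesis
      unfolding flux_def using P_pos[OF \<open>r > 0\<close>] by (simp add: pos_divide_le_eq mult.commute)
  qed
qed

text \<open>Only the origin is in question, since the derivative formula covers
  \<open>r > 0\<close>. There \<open>flux g\<close> is squeezed between 0 and a power of
  \<open>r\<close>.\<close>

lemma continuous_on_flux:
  assumes cont: "continuous_on {0..} g"
    and g: "\<And>t. t > 0 \<Longrightarrow> g t > 0" "\<And>t. t > 0 \<Longrightarrow> g t \<le> t ^ n / fact n"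
  shows "continuous_on {0..} (flux g)"
  unfolding continuous_on_eq_continuous_within
proof
  fix r :: real assume "r \<in> {0..}"
  show "continuous (at r within {0..}) (flux g)"
  proof (cases "r = 0")
    case False
    with \<open>r \<in> _\<close> have "isCont (flux g) r"
      using flux_deriv[OF cont, of r] DERIV_isCont by fastforce
    then show ?thesis by (rule continuous_at_imp_continuous_within)
  next
    case True
    have bounds: "\<forall>\<^sub>F r in at 0 within {0..}. 0 \<le> flux g r \<and> flux g r \<le> r ^ Suc n / fact (Suc n)"
      unfolding eventually_at_filter
    proof (intro always_eventually allI impI)
      fix r :: real assume "r \<noteq> 0" "r \<in> {0..}"
      then have "r > 0" by simp
      then show "0 \<le> flux g r \<and> flux g r \<le> r ^ Suc n / fact (Suc n)"
        using flux_pos[OF cont _ g(1), of r] flux_le[OF cont _ g(2), of r] by (simp del: fact_Suc)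
    qed
    have "(flux g \<longlongrightarrow> 0) (at 0 within {0..})"
    proof (rule tendsto_sandwich[where f = "\<lambda>_. 0" and h = "\<lambda>r. r ^ Suc n / fact (Suc n)"])
      have "((\<lambda>r::real. r ^ Suc n / fact (Suc n)) \<longlongrightarrow> 0 ^ Suc n / fact (Suc n)) (at 0 within {0..})"
        by (intro tendsto_intros) simp
      then show "((\<lambda>r::real. r ^ Suc n / fact (Suc n)) \<longlongrightarrow> 0) (at 0 within {0..})" by simp
    qed (use bounds in \<open>simp_all only: eventually_conj_iff tendsto_const\<close>)
    with True show ?thesis by (simp add: continuous_within)
  qed
qed

primrec a :: "nat \<Rightarrow> real \<Rightarrow> real" where
  "a 0 = (\<lambda>r. 1)"
| "a (Suc n) = (\<lambda>r. integral {0..r} (flux (a n)))"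

text \<open>The three properties need a joint induction: continuity of \<open>flux (a n)\<close> at
  0 is derived from both positivity and the upper bound.\<close>

lemma a_facts:
  "continuous_on {0..} (a n) \<and> (\<forall>t>0. a n t > 0) \<and> (\<forall>t>0. a n t \<le> t ^ (2 * n) / fact (2 * n))"
proof (induction n)
  case (Suc n)
  then have a: "continuous_on {0..} (a n)" "\<And>t. t > 0 \<Longrightarrow> a n t > 0"
    "\<And>t. t > 0 \<Longrightarrow> a n t \<le> t ^ (2 * n) / fact (2 * n)" by auto
  note fc = continuous_on_flux[OF a]
  have "continuous_on {0..} (a (Suc n))"
    using integral_from_0_continuous_on[OF fc] by (intro continuous_on_half_lineI) simp
  moreover have "a (Suc n) t > 0" if "t > 0" for t
    using integral_from_0_pos[OF fc flux_pos[OF a(1) _ a(2)] that] by simp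
  moreover have "a (Suc n) t \<le> t ^ (2 * Suc n) / fact (2 * Suc n)" if "t > 0" for t
  proof -
    have "integral {0..t} (flux (a n)) \<le> 1 * (t ^ Suc (Suc (2 * n)) / fact (Suc (Suc (2 * n))))"
      using flux_le[OF a(1) _ a(3)] that by (intro integral_from_0_le[OF fc]) auto
    then show ?thesis by simp
  qed
  ultimately show ?case by blast
qed auto

lemma continuous_on_a: "continuous_on {0..} (a n)"
  and a_pos: "r > 0 \<Longrightarrow> a n r > 0"
  and a_le: "r > 0 \<Longrightarrow> a n r \<le> r ^ (2 * n) / fact (2 * n)"
  using a_facts by auto

end

section \<open>The power series solution\<close>

lemma continuous_on_suminf_M:
  fixes f :: "nat \<Rightarrow> 'a::topological_space \<Rightarrow> 'b::banach"
  assumes "\<And>n. continuous_on X (f n)" "\<And>n x. x \<in> X \<Longrightarrow> norm (f n x) \<le> M n" "summable M"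
  shows "continuous_on X (\<lambda>x. \<Sum>n. f n x)"
  by (rule uniform_limit_theorem[OF always_eventually Weierstrass_m_test[OF assms(2,3)]])
    (auto intro!: continuous_on_sum assms)

lemma has_vector_derivative_suminf:
  fixes f :: "nat \<Rightarrow> real \<Rightarrow> 'b::banach"
  assumes X: "convex X" "open X"
    and der: "\<And>n x. x \<in> X \<Longrightarrow> (f n has_vector_derivative f' n x) (at x)"
    and M: "\<And>n x. x \<in> X \<Longrightarrow> norm (f' n x) \<le> M n" "summable M"
    and summable: "\<And>x. x \<in> X \<Longrightarrow> summable (\<lambda>n. f n x)" and "x \<in> X"
  shows "((\<lambda>x. \<Sum>n. f n x) has_vector_derivative (\<Sum>n. f' n x)) (at x)"
proof -
  have "\<exists>g. \<forall>x\<in>X. (\<lambda>n. f n x) sums g x \<and>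
      (g has_derivative (\<lambda>h. h *\<^sub>R (\<Sum>n. f' n x))) (at x within X)"
  proof (rule has_derivative_series[OF X(1)])
    show "(f n has_derivative (\<lambda>h. h *\<^sub>R f' n x)) (at x within X)" if "x \<in> X" for n x
      using der[OF that] has_derivative_at_withinI unfolding has_vector_derivative_def by blast
    show "\<forall>\<^sub>F n in sequentially. \<forall>x\<in>X. \<forall>h.
        norm ((\<Sum>i<n. h *\<^sub>R f' i x) - h *\<^sub>R (\<Sum>n. f' n x)) \<le> e * norm h" if "e > 0" for e
    proof -
      have "uniform_limit X (\<lambda>n x. \<Sum>i<n. f' i x) (\<lambda>x. \<Sum>n. f' n x) sequentially"
        by (rule Weierstrass_m_test[OF M])
      then have "\<forall>\<^sub>F n in sequentially. \<forall>x\<in>X. norm ((\<Sum>i<n. f' i x) - (\<Sum>n. f' n x)) < e"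
        using that unfolding uniform_limit_iff dist_norm by blast
      then show ?thesis
      proof eventually_elim
        case (elim n)
        show ?case
        proof safe
          fix x h assume "x \<in> X"
          have "norm ((\<Sum>i<n. h *\<^sub>R f' i x) - h *\<^sub>R (\<Sum>n. f' n x)) =
              \<bar>h\<bar> * norm ((\<Sum>i<n. f' i x) - (\<Sum>n. f' n x))"
            by (simp flip: scaleR_sum_right scaleR_diff_right)
          also have "\<dots> \<le> \<bar>h\<bar> * e"
            using elim \<open>x \<in> X\<close> by (intro mult_left_mono) (auto intro: less_imp_le)
          finally show "norm ((\<Sum>i<n. h *\<^sub>R f' i x) - h *\<^sub>R (\<Sum>n. f' n x)) \<le> e * norm h"
            by (simp add: mult.commute)
        qed
      qed
    qed
    show "x \<in> X" "(\<lambda>n. f n x) sums (\<Sum>n. f n x)"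
      using \<open>x \<in> X\<close> summable by (auto simp: summable_sums)
  qed
  then obtain g where g: "\<And>x. x \<in> X \<Longrightarrow> (\<lambda>n. f n x) sums g x"
      "(g has_vector_derivative (\<Sum>n. f' n x)) (at x within X)"
    using \<open>x \<in> X\<close> unfolding has_vector_derivative_def by blast
  then have "(g has_vector_derivative (\<Sum>n. f' n x)) (at x)"
    using at_within_open[OF \<open>x \<in> X\<close> X(2)] by simp
  then show ?thesis
    by (rule has_vector_derivative_transform_within_open[OF _ X(2) \<open>x \<in> X\<close>])
      (simp add: sums_unique[OF g(1)])
qed

lemma summable_even_powers:
  fixes x :: real
  assumes "x \<ge> 0"
  shows "summable (\<lambda>n. x ^ n / fact (2 * n))"
proof (rule summable_comparison_test')
  show "summable (\<lambda>n. x ^ n / fact n)"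
    using summable_exp_generic[of x] by (simp add: divide_inverse mult.commute)
  show "norm (x ^ n / fact (2 * n)) \<le> x ^ n / fact n" if "n \<ge> 0" for n
    using assms by (auto intro!: divide_left_mono fact_mono)
qed

context hyperbolic
begin

definition sol :: "complex \<Rightarrow> real \<Rightarrow> complex" where
  "sol \<mu> r = (\<Sum>n. of_real (a n r) * (- \<mu>) ^ n)"

text \<open>The termwise derivative of \<open>sol\<close>: the constant \<open>a 0\<close> drops out
  and \<open>a (Suc n)\<close> has derivative \<open>flux (a n)\<close>, whence the exponent
  \<open>Suc n\<close>.\<close>

definition sol_deriv :: "complex \<Rightarrow> real \<Rightarrow> complex" where
  "sol_deriv \<mu> r = (\<Sum>n. of_real (flux (a n) r) * (- \<mu>) ^ Suc n)"

text \<open>The equation solved for the second derivative and written as a first-order system, so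
  that both functions can be carried along together.\<close>

definition ode :: "complex \<Rightarrow> (real \<Rightarrow> complex) \<Rightarrow> (real \<Rightarrow> complex) \<Rightarrow> bool" where
  "ode \<mu> \<phi> \<phi>' \<longleftrightarrow> (\<forall>r>0. (\<phi> has_vector_derivative \<phi>' r) (at r) \<and>
     (\<phi>' has_vector_derivative - of_real (coth_coeff r) * \<phi>' r - \<mu> * \<phi> r) (at r))"

lemma a_ge_0: "r \<ge> 0 \<Longrightarrow> a n r \<ge> 0" and a_le': "r \<ge> 0 \<Longrightarrow> a n r \<le> r ^ (2 * n) / fact (2 * n)"
  using a_pos[of r n] a_le[of r n] by (cases "r = 0"; cases n; force)+

lemma flux_a_ge_0: "r \<ge> 0 \<Longrightarrow> flux (a n) r \<ge> 0"
  using flux_pos[OF continuous_on_a _ a_pos, of r n] by (cases "r = 0") auto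

text \<open>The factorial is weakened from \<open>2 * n + 1\<close> to \<open>2 * n\<close> so that
  \<open>sol\<close> and \<open>sol_deriv\<close> share one summable majorant up to a
  constant.\<close>

lemma flux_a_le: "r \<ge> 0 \<Longrightarrow> flux (a n) r \<le> r * (r ^ (2 * n) / fact (2 * n))"
proof (cases "r = 0")
  case False
  assume "r \<ge> 0"
  with False have "r > 0" by simp
  then have "flux (a n) r \<le> r ^ Suc (2 * n) / fact (Suc (2 * n))"
    using flux_le[OF continuous_on_a _ a_le] by simp
  also have "\<dots> \<le> r ^ Suc (2 * n) / fact (2 * n)"
    using \<open>r > 0\<close> by (intro divide_left_mono fact_mono) auto
  finally show ?thesis by simp
qed simp

lemma continuous_on_flux_a: "continuous_on {0..} (flux (a n))"
  by (rule continuous_on_flux[OF continuous_on_a a_pos a_le])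

lemma a_term_le:
  fixes \<mu> :: complex
  assumes "0 \<le> r" "r \<le> R"
  shows "norm (of_real (a n r) * (- \<mu>) ^ n) \<le> (norm \<mu> * R\<^sup>2) ^ n / fact (2 * n)"
proof -
  have "norm (of_real (a n r) * (- \<mu>) ^ n) = a n r * norm \<mu> ^ n"
    using a_ge_0[OF assms(1)] by (simp add: norm_mult norm_power)
  also have "\<dots> \<le> r ^ (2 * n) / fact (2 * n) * norm \<mu> ^ n"
    using a_le'[OF assms(1)] by (intro mult_right_mono) auto
  also have "\<dots> \<le> R ^ (2 * n) / fact (2 * n) * norm \<mu> ^ n"
    using assms by (intro mult_right_mono divide_right_mono power_mono) auto
  finally show ?thesis by (simp add: power_mult_distrib mult.commute flip: power_mult)
qed

lemma flux_a_term_le: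
  fixes \<mu> :: complex
  assumes "0 \<le> r" "r \<le> R"
  shows "norm (of_real (flux (a n) r) * (- \<mu>) ^ Suc n) \<le>
    R * norm \<mu> * ((norm \<mu> * R\<^sup>2) ^ n / fact (2 * n))"
proof -
  have "norm (of_real (flux (a n) r) * (- \<mu>) ^ Suc n) = flux (a n) r * norm \<mu> ^ Suc n"
    using flux_a_ge_0[OF assms(1)] by (simp add: norm_mult norm_power)
  also have "\<dots> \<le> r * (r ^ (2 * n) / fact (2 * n)) * norm \<mu> ^ Suc n"
    using flux_a_le[OF assms(1)] by (intro mult_right_mono) auto
  also have "\<dots> \<le> R * (R ^ (2 * n) / fact (2 * n)) * norm \<mu> ^ Suc n"
    using assms by (intro mult_right_mono mult_mono divide_right_mono power_mono) auto
  finally show ?thesis by (simp add: power_mult_distrib mult_ac flip: power_mult)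
qed

lemma summable_a_bound: "summable (\<lambda>n. (norm (\<mu>::complex) * R\<^sup>2) ^ n / fact (2 * n))"
  by (rule summable_even_powers) simp

lemmas summable_flux_a_bound = summable_mult[OF summable_a_bound, of "R * norm \<mu>" for R \<mu>]

lemma summable_a: "r \<ge> 0 \<Longrightarrow> summable (\<lambda>n. of_real (a n r) * (- \<mu>) ^ n :: complex)"
  by (rule summable_comparison_test'[OF summable_a_bound a_term_le[where R = r]]) auto

lemma summable_flux_a:
  "r \<ge> 0 \<Longrightarrow> summable (\<lambda>n. of_real (flux (a n) r) * (- \<mu>) ^ Suc n :: complex)"
  by (rule summable_comparison_test'[OF summable_flux_a_bound flux_a_term_le[where R = r]]) auto

lemma continuous_on_sol: "continuous_on {0..} (sol \<mu>)"
  unfolding sol_def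
  by (intro continuous_on_half_lineI continuous_on_suminf_M[OF _ a_term_le summable_a_bound]
      continuous_intros continuous_on_subset[OF continuous_on_a]) auto

lemma continuous_on_sol_deriv: "continuous_on {0..} (sol_deriv \<mu>)"
  unfolding sol_deriv_def
  by (intro continuous_on_half_lineI continuous_on_suminf_M[OF _ flux_a_term_le summable_flux_a_bound]
      continuous_intros continuous_on_subset[OF continuous_on_flux_a]) auto

lemma sol_0 [simp]: "sol \<mu> 0 = 1"
proof -
  have "(\<lambda>n. of_real (a n 0) * (- \<mu>) ^ n) = (\<lambda>n. if n = 0 then 1 else 0)"
    by (auto simp: fun_eq_iff gr0_conv_Suc)
  then show ?thesis
    using sums_single[of 0 "\<lambda>_. 1 :: complex"] by (simp add: sol_def sums_iff)
qed

lemma sol_deriv_0 [simp]: "sol_deriv \<mu> 0 = 0"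
  by (simp add: sol_deriv_def)

text \<open>For the second derivative the series of \<open>P * sol_deriv\<close> is differentiated
  instead of \<open>sol_deriv\<close>: the derivative of \<open>P * flux (a n)\<close> is just
  \<open>P * a n\<close>, with no \<open>coth_coeff\<close> left to majorize. Dividing by
  \<open>P\<close> afterwards brings it back.\<close>

lemma ode_sol: "ode \<mu> (sol \<mu>) (sol_deriv \<mu>)"
  unfolding ode_def
proof (intro allI impI conjI)
  fix r :: real assume "r > 0"
  \<comment> \<open>A bounded neighbourhood of \<open>r\<close>, so that the majorants with
    \<open>R = r + 1\<close> hold uniformly.\<close>
  define X where "X = {0<..<r + 1}"
  have X: "convex X" "open X" "r \<in> X" using \<open>r > 0\<close> by (auto simp: X_def)
  have "((\<lambda>r. \<Sum>n. of_real (a (Suc n) r) * (- \<mu>) ^ Suc n) has_vector_derivative sol_deriv \<mu> r) (at r)"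
    unfolding sol_deriv_def
  proof (rule has_vector_derivative_suminf[OF X(1,2) _ flux_a_term_le[where R = "r + 1"]
        summable_flux_a_bound _ X(3)])
    fix n x assume "x \<in> X"
    then have "x > 0" by (simp add: X_def)
    have "((\<lambda>r. of_real (a (Suc n) r)) has_vector_derivative complex_of_real (flux (a n) x)) (at x)"
      using integral_from_0_has_real_derivative[OF continuous_on_flux_a \<open>x > 0\<close>]
      by (auto intro!: has_vector_derivative_of_real simp: has_real_derivative_iff_has_vector_derivative)
    then show "((\<lambda>r. of_real (a (Suc n) r) * (- \<mu>) ^ Suc n) has_vector_derivative
        of_real (flux (a n) x) * (- \<mu>) ^ Suc n) (at x)"
      by (rule has_vector_derivative_mult_left)
  next
    fix x assume "x \<in> X"
    then show "summable (\<lambda>n. of_real (a (Suc n) x) * (- \<mu>) ^ Suc n)"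
      using summable_Suc_iff[of "\<lambda>n. of_real (a n x) * (- \<mu>) ^ n"] summable_a[of x \<mu>]
      by (simp add: X_def)
  qed (auto simp: X_def)
  then have "((\<lambda>r. 1 + (\<Sum>n. of_real (a (Suc n) r) * (- \<mu>) ^ Suc n)) has_vector_derivative sol_deriv \<mu> r) (at r)"
    by (auto intro!: derivative_eq_intros)
  then show "(sol \<mu> has_vector_derivative sol_deriv \<mu> r) (at r)"
  proof (rule has_vector_derivative_transform_within_open[OF _ X(2,3)])
    fix x assume "x \<in> X"
    then show "1 + (\<Sum>n. of_real (a (Suc n) x) * (- \<mu>) ^ Suc n) = sol \<mu> x"
      unfolding sol_def using suminf_split_head[OF summable_a[of x \<mu>]] by (simp add: X_def)
  qed
  have D': "((\<lambda>r. \<Sum>n. of_real (P r * flux (a n) r) * (- \<mu>) ^ Suc n) has_vector_derivative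
      (\<Sum>n. of_real (P r * a n r) * (- \<mu>) ^ Suc n)) (at r)"
  proof (rule has_vector_derivative_suminf[OF X(1,2) _ _
        summable_mult[OF summable_a_bound, of "P (r + 1) * norm \<mu>" \<mu> "r + 1"] _ X(3)])
    fix n x assume "x \<in> X"
    then have x: "x > 0" "x < r + 1" by (auto simp: X_def)
    have "((\<lambda>r. P r * flux (a n) r) has_real_derivative P x * a n x) (at x)"
      using DERIV_mult[OF P_deriv[OF x(1)] flux_deriv[OF continuous_on_a x(1), of n]]
      by (simp add: algebra_simps)
    then have "((\<lambda>r. of_real (P r * flux (a n) r)) has_vector_derivative complex_of_real (P x * a n x)) (at x)"
      by (intro has_vector_derivative_of_real) (simp add: has_real_derivative_iff_has_vector_derivative)
    then show "((\<lambda>r. of_real (P r * flux (a n) r) * (- \<mu>) ^ Suc n) has_vector_derivative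
        of_real (P x * a n x) * (- \<mu>) ^ Suc n) (at x)"
      by (rule has_vector_derivative_mult_left)
    have "norm (of_real (P x * a n x) * (- \<mu>) ^ Suc n) =
        (P x * norm \<mu>) * norm (of_real (a n x) * (- \<mu>) ^ n)"
      using P_nonneg[of x] x by (simp add: norm_mult)
    also have "\<dots> \<le> (P (r + 1) * norm \<mu>) * ((norm \<mu> * (r + 1)\<^sup>2) ^ n / fact (2 * n))"
      using x P_nonneg[of x] by (intro mult_mono P_mono a_term_le mult_nonneg_nonneg) (auto intro!: P_nonneg)
    finally show "norm (of_real (P x * a n x) * (- \<mu>) ^ Suc n) \<le>
        (P (r + 1) * norm \<mu>) * ((norm \<mu> * (r + 1)\<^sup>2) ^ n / fact (2 * n))" .
  next
    fix x assume "x \<in> X"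
    then show "summable (\<lambda>n. of_real (P x * flux (a n) x) * (- \<mu>) ^ Suc n)"
      using summable_mult[OF summable_flux_a[of x \<mu>], of "of_real (P x)"]
      by (simp add: X_def mult.assoc)
  qed
  have eq1: "(\<Sum>n. of_real (P x * flux (a n) x) * (- \<mu>) ^ Suc n) = of_real (P x) * sol_deriv \<mu> x"
    if "x \<in> X" for x
    unfolding sol_deriv_def using suminf_mult[OF summable_flux_a[of x \<mu>], of "of_real (P x)"] that
    by (simp add: X_def mult.assoc)
  have eq2: "(\<Sum>n. of_real (P r * a n r) * (- \<mu>) ^ Suc n) = - \<mu> * of_real (P r) * sol \<mu> r"
    unfolding sol_def using suminf_mult[OF summable_a[of r \<mu>], of "- \<mu> * of_real (P r)"] \<open>r > 0\<close>
    by (simp add: mult_ac)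
  have D: "((\<lambda>x. of_real (P x) * sol_deriv \<mu> x) has_vector_derivative
      - \<mu> * of_real (P r) * sol \<mu> r) (at r)"
    using has_vector_derivative_transform_within_open[OF D' X(2,3) eq1] unfolding eq2 .
  have "P r \<noteq> 0" using P_pos[OF \<open>r > 0\<close>] by simp
  have "((\<lambda>x. inverse (P x)) has_real_derivative - (coth_coeff r * inverse (P r))) (at r)"
    using DERIV_inverse_fun[OF P_deriv[OF \<open>r > 0\<close>] \<open>P r \<noteq> 0\<close>] \<open>P r \<noteq> 0\<close>
    by (simp add: field_simps)
  then have "((\<lambda>x. inverse (P x) *\<^sub>R (of_real (P x) * sol_deriv \<mu> x)) has_vector_derivative
      inverse (P r) *\<^sub>R (- \<mu> * of_real (P r) * sol \<mu> r) +
      (- (coth_coeff r * inverse (P r))) *\<^sub>R (of_real (P r) * sol_deriv \<mu> r)) (at r)"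
    by (rule has_vector_derivative_scaleR[OF _ D])
  moreover have "inverse (P r) *\<^sub>R (- \<mu> * of_real (P r) * sol \<mu> r) +
      (- (coth_coeff r * inverse (P r))) *\<^sub>R (of_real (P r) * sol_deriv \<mu> r) =
      - of_real (coth_coeff r) * sol_deriv \<mu> r - \<mu> * sol \<mu> r"
    using \<open>P r \<noteq> 0\<close> by (simp add: scaleR_conv_of_real field_simps)
  ultimately have "((\<lambda>x. inverse (P x) *\<^sub>R (of_real (P x) * sol_deriv \<mu> x)) has_vector_derivative
      - of_real (coth_coeff r) * sol_deriv \<mu> r - \<mu> * sol \<mu> r) (at r)"
    by simp
  then show "(sol_deriv \<mu> has_vector_derivative - of_real (coth_coeff r) * sol_deriv \<mu> r - \<mu> * sol \<mu> r) (at r)"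
  proof (rule has_vector_derivative_transform_within_open[OF _ X(2,3)])
    fix x assume "x \<in> X"
    then show "inverse (P x) *\<^sub>R (of_real (P x) * sol_deriv \<mu> x) = sol_deriv \<mu> x"
      using P_pos[of x] by (simp add: X_def scaleR_conv_of_real)
  qed
qed

end

section \<open>Uniqueness and behaviour at the origin\<close>

lemma norm_le_power_if_deriv_le:
  fixes f :: "real \<Rightarrow> 'b::real_normed_vector"
  assumes "r > 0" and cont: "continuous_on {0..r} f" and "f 0 = 0"
    and f': "\<And>t. 0 < t \<Longrightarrow> t < r \<Longrightarrow> (f has_vector_derivative f' t) (at t)"
    and le: "\<And>t. 0 < t \<Longrightarrow> t < r \<Longrightarrow> norm (f' t) \<le> C * (t ^ n / fact n)"
  shows "norm (f r) \<le> C * (r ^ Suc n / fact (Suc n))"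
proof -
  have "norm (f r - f 0) \<le> C * (r ^ Suc n / fact (Suc n)) - C * (0 ^ Suc n / fact (Suc n))"
  proof (rule differentiable_bound_general[OF \<open>r > 0\<close> cont _ f' _ le])
    fix t :: real
    show "((\<lambda>t. C * (t ^ Suc n / fact (Suc n))) has_vector_derivative C * (t ^ n / fact n)) (at t)"
      using DERIV_cmult[OF DERIV_cdivide[OF DERIV_pow[of "Suc n" t UNIV], of "fact (Suc n)"], of C]
      by (simp add: has_real_derivative_iff_has_vector_derivative del: of_nat_Suc)
  qed (auto intro!: continuous_intros)
  then show ?thesis using \<open>f 0 = 0\<close> by simp
qed

context hyperbolic
begin

lemma ode_flux_deriv:
  assumes "ode \<mu> \<phi> \<phi>'" "r > 0"
  shows "((\<lambda>r. P r *\<^sub>R \<phi>' r) has_vector_derivative P r *\<^sub>R (- \<mu> * \<phi> r)) (at r)"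
proof -
  have "((\<lambda>r. P r *\<^sub>R \<phi>' r) has_vector_derivative
      P r *\<^sub>R (- of_real (coth_coeff r) * \<phi>' r - \<mu> * \<phi> r) + (coth_coeff r * P r) *\<^sub>R \<phi>' r) (at r)"
    using assms by (intro has_vector_derivative_scaleR P_deriv) (auto simp: ode_def)
  then show ?thesis by (simp add: scaleR_conv_of_real algebra_simps)
qed

lemma ode_diff:
  assumes "ode \<mu> \<phi> \<phi>'" "ode \<mu> \<psi> \<psi>'"
  shows "ode \<mu> (\<lambda>r. \<phi> r - \<psi> r) (\<lambda>r. \<phi>' r - \<psi>' r)"
  unfolding ode_def
proof (intro allI impI conjI)
  fix r :: real assume "r > 0"
  then show "((\<lambda>r. \<phi> r - \<psi> r) has_vector_derivative \<phi>' r - \<psi>' r) (at r)"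
    using assms unfolding ode_def by (intro has_vector_derivative_diff) auto
  have "((\<lambda>r. \<phi>' r - \<psi>' r) has_vector_derivative
     (- of_real (coth_coeff r) * \<phi>' r - \<mu> * \<phi> r) - (- of_real (coth_coeff r) * \<psi>' r - \<mu> * \<psi> r)) (at r)"
    using assms \<open>r > 0\<close> unfolding ode_def by (intro has_vector_derivative_diff) auto
  then show "((\<lambda>r. \<phi>' r - \<psi>' r) has_vector_derivative
     - of_real (coth_coeff r) * (\<phi>' r - \<psi>' r) - \<mu> * (\<phi> r - \<psi> r)) (at r)"
    by (simp add: algebra_simps)
qed

text \<open>Two integrations of the equation improve a bound of order \<open>r^(2 n)\<close> to one of order
  \<open>r^(2 n + 2)\<close>, gaining a factorial.\<close>

lemma ode_unique_zero:
  assumes "k > 0" and ode: "ode \<mu> \<phi> \<phi>'" and cont: "continuous_on {0..} \<phi>" and "\<phi> 0 = 0"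
    and bounded: "\<And>r. 0 < r \<Longrightarrow> r < \<delta> \<Longrightarrow> norm (\<phi>' r) \<le> B" and "\<delta> > 0" and "r \<ge> 0"
  shows "\<phi> r = 0"
proof -
  \<comment> \<open>This is the flux \<open>P * \<phi>'\<close>. Bounded \<open>\<phi>'\<close> and
    \<open>P 0 = 0\<close> make it continuous with value 0 at the origin, so it can be integrated
    from there; for the singular solution it would have a nonzero limit.\<close>
  define F where "F t = P t *\<^sub>R (if t = 0 then 0 else \<phi>' t)" for t
  have "P 0 = 0" using \<open>k > 0\<close> by (simp add: P_def)
  have F_deriv: "(F has_vector_derivative P t *\<^sub>R (- \<mu> * \<phi> t)) (at t)" if "t > 0" for t
    by (rule has_vector_derivative_transform_within_open[OF ode_flux_deriv[OF ode that], of "{0<..}"])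
      (use that in \<open>auto simp: F_def\<close>)
  have F_cont: "continuous_on {0..} F"
    unfolding continuous_on_eq_continuous_within
  proof
    fix t :: real assume "t \<in> {0..}"
    show "continuous (at t within {0..}) F"
    proof (cases "t = 0")
      case False
      with \<open>t \<in> _\<close> have "isCont F t"
        using F_deriv[of t] has_vector_derivative_continuous by force
      then show ?thesis by (rule continuous_at_imp_continuous_within)
    next
      case True
      have "(F \<longlongrightarrow> 0) (at 0 within {0..})"
      proof (rule Lim_null_comparison)
        have "\<forall>\<^sub>F t in at 0 within {0..}. t \<in> {0..} \<and> t \<noteq> 0 \<and> t < \<delta>"
          using \<open>\<delta> > 0\<close> unfolding eventually_at by (intro exI[of _ \<delta>]) (auto simp: dist_real_def)
        then show "\<forall>\<^sub>F t in at 0 within {0..}. norm (F t) \<le> P t * B"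
        proof eventually_elim
          case (elim t)
          then have "norm (\<phi>' t) \<le> B" using bounded[of t] by auto
          then show ?case
            using elim P_nonneg[of t] by (simp add: F_def mult_left_mono)
        qed
        have "(P \<longlongrightarrow> P 0) (at 0 within {0..})"
          using continuous_on_P[of "{0..}"] by (auto simp: continuous_on_def)
        then show "((\<lambda>t. P t * B) \<longlongrightarrow> 0) (at 0 within {0..})"
          using tendsto_mult_left_zero[of P "at 0 within {0..}" B] \<open>P 0 = 0\<close> by simp
      qed
      then show ?thesis using True by (simp add: continuous_within F_def)
    qed
  qed
  have "bounded (\<phi> ` {0..r})"
    by (intro compact_imp_bounded compact_continuous_image continuous_on_subset[OF cont]) auto
  then obtain M where M: "\<And>t. t \<in> {0..r} \<Longrightarrow> norm (\<phi> t) \<le> M"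
    unfolding bounded_iff by blast
  have M0: "M \<ge> 0" using M[of r] \<open>r \<ge> 0\<close> by (smt (verit) atLeastAtMost_iff norm_ge_zero)
  have iterate: "\<forall>t\<in>{0..r}. norm (\<phi> t) \<le> M * norm \<mu> ^ n * (t ^ (2 * n) / fact (2 * n))" for n
  proof (induction n)
    case 0
    then show ?case using M by auto
  next
    case (Suc n)
    define C where "C = M * norm \<mu> ^ Suc n"
    have F_le: "norm (\<phi>' t) \<le> C * (t ^ Suc (2 * n) / fact (Suc (2 * n)))" if t: "0 < t" "t \<le> r" for t
    proof -
      have "norm (F t) \<le> P t * C * (t ^ Suc (2 * n) / fact (Suc (2 * n)))"
      proof (rule norm_le_power_if_deriv_le[OF t(1) _ _ F_deriv])
        fix s assume s: "0 < s" "s < t"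
        have "norm (P s *\<^sub>R (- \<mu> * \<phi> s)) = P s * norm \<mu> * norm (\<phi> s)"
          using P_nonneg[of s] s by (simp add: norm_mult)
        also have "\<dots> \<le> P t * norm \<mu> * (M * norm \<mu> ^ n * (s ^ (2 * n) / fact (2 * n)))"
          using Suc.IH s t P_mono[of s t] P_nonneg[of t]
          by (intro mult_mono) (auto intro!: mult_nonneg_nonneg)
        finally show "norm (P s *\<^sub>R (- \<mu> * \<phi> s)) \<le> P t * C * (s ^ (2 * n) / fact (2 * n))"
          by (simp add: C_def mult_ac)
      qed (use \<open>P 0 = 0\<close> continuous_on_subset[OF F_cont, of "{0..t}"] in \<open>auto simp: F_def\<close>)
      then have "P t * norm (\<phi>' t) \<le> P t * (C * (t ^ Suc (2 * n) / fact (Suc (2 * n))))"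
        using t P_pos[OF t(1)] by (simp add: F_def mult.assoc)
      then show ?thesis using P_pos[OF t(1)] by (rule mult_left_le_imp_le)
    qed
    show ?case
    proof
      fix t assume "t \<in> {0..r}"
      have "norm (\<phi> t) \<le> C * (t ^ Suc (Suc (2 * n)) / fact (Suc (Suc (2 * n))))"
      proof (cases "t = 0")
        case True
        then show ?thesis using \<open>\<phi> 0 = 0\<close> by simp
      next
        case False
        with \<open>t \<in> _\<close> have t: "0 < t" "t \<le> r" by auto
        show ?thesis
          by (rule norm_le_power_if_deriv_le[OF t(1) continuous_on_subset[OF cont] \<open>\<phi> 0 = 0\<close> _ F_le])
            (use ode t in \<open>auto simp: ode_def\<close>)
      qed
      then show "norm (\<phi> t) \<le> M * norm \<mu> ^ Suc n * (t ^ (2 * Suc n) / fact (2 * Suc n))"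
        by (simp add: C_def)
    qed
  qed
  have "(\<lambda>n. M * ((norm \<mu> * r\<^sup>2) ^ n / fact (2 * n))) \<longlonglongrightarrow> M * 0"
    by (intro tendsto_intros summable_LIMSEQ_zero summable_a_bound)
  moreover have "norm (\<phi> r) \<le> M * ((norm \<mu> * r\<^sup>2) ^ n / fact (2 * n))" for n
    using iterate[of n] \<open>r \<ge> 0\<close> by (auto simp: power_mult_distrib mult_ac simp flip: power_mult)
  ultimately have "norm (\<phi> r) \<le> M * 0"
    by (intro LIMSEQ_le_const) auto
  then show ?thesis by simp
qed

text \<open>Near 0 the flux \<open>P * sol_deriv\<close> is about \<open>- \<mu>\<close> times the
  integral of \<open>P\<close>. The comparison function \<open>?c * S r ^ Suc k\<close> has
  derivative exactly \<open>P r * cosh (r / \<rho>)\<close>, so the discrepancy \<open>H\<close> has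
  a derivative proportional to \<open>sol - cosh\<close>, which tends to 0 because both functions
  equal 1 at the origin.\<close>

lemma sol_deriv_over_S_tendsto:
  "((\<lambda>r. sol_deriv \<mu> r / of_real (S r)) \<longlongrightarrow> - \<mu> * of_real (\<rho> / real (Suc k))) (at_right 0)"
  (is "(_ \<longlongrightarrow> - \<mu> * of_real ?c) _")
proof (rule tendstoI)
  fix e :: real assume "e > 0"
  define H where "H r = P r *\<^sub>R sol_deriv \<mu> r + (?c * S r ^ Suc k) *\<^sub>R \<mu>" for r
  have S_Suc_deriv: "((\<lambda>r. ?c * S r ^ Suc k) has_real_derivative P r * cosh (r / \<rho>)) (at r)" for r
    using DERIV_cmult[OF DERIV_power[OF S_deriv, of "Suc k"], of ?c] rho_pos
    by (simp add: P_def mult_ac del: of_nat_Suc)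
  have H_deriv: "(H has_vector_derivative P r *\<^sub>R (- \<mu> * (sol \<mu> r - of_real (cosh (r / \<rho>))))) (at r)"
    if "r > 0" for r
  proof -
    have "(H has_vector_derivative P r *\<^sub>R (- \<mu> * sol \<mu> r) + (P r * cosh (r / \<rho>)) *\<^sub>R \<mu>) (at r)"
      unfolding H_def
      using has_vector_derivative_scaleR[OF S_Suc_deriv has_vector_derivative_const]
      by (intro has_vector_derivative_add ode_flux_deriv[OF ode_sol that]) simp
    then show ?thesis by (simp add: scaleR_conv_of_real algebra_simps)
  qed
  have H_cont: "continuous_on {0..r} H" for r
    unfolding H_def
    by (intro continuous_intros continuous_on_subset[OF continuous_on_sol_deriv]) auto
  \<comment> \<open>Chosen so that the final bound \<open>norm \<mu> * e' * \<rho>\<close> is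
    \<open>e * (norm \<mu> / (norm \<mu> + 1))\<close>, which is below \<open>e\<close> for
    \<open>\<mu> = 0\<close> as well.\<close>
  define e' where "e' = e / (norm \<mu> + 1) / \<rho>"
  have "e' > 0" using \<open>e > 0\<close> rho_pos by (simp add: e'_def add_nonneg_pos)
  have "continuous_on {0..} (\<lambda>r. sol \<mu> r - of_real (cosh (r / \<rho>)))"
    using rho_pos by (intro continuous_intros continuous_on_sol) auto
  then have "((\<lambda>r. sol \<mu> r - of_real (cosh (r / \<rho>))) \<longlongrightarrow> 0) (at 0 within {0..})"
    unfolding continuous_on_def by force
  then have "\<forall>\<^sub>F r in at 0 within {0..}. norm (sol \<mu> r - of_real (cosh (r / \<rho>))) < e'"
    using \<open>e' > 0\<close> by (auto dest: tendstoD)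
  then obtain d where "d > 0" and d: "\<And>r. 0 < r \<Longrightarrow> r < d \<Longrightarrow> norm (sol \<mu> r - of_real (cosh (r / \<rho>))) < e'"
    unfolding eventually_at by (auto simp: dist_real_def)
  have "dist (sol_deriv \<mu> r / of_real (S r)) (- \<mu> * of_real ?c) < e" if r: "0 < r" "r < d" for r
  proof -
    have "norm (H r - H 0) \<le> norm \<mu> * e' * (?c * S r ^ Suc k) - norm \<mu> * e' * (?c * S 0 ^ Suc k)"
    proof (rule differentiable_bound_general[OF r(1) H_cont _ H_deriv])
      fix t assume "0 < t" "t < r"
      show "((\<lambda>t. norm \<mu> * e' * (?c * S t ^ Suc k)) has_vector_derivative
          norm \<mu> * e' * (P t * cosh (t / \<rho>))) (at t)"
        by (intro has_real_derivative_iff_has_vector_derivative[THEN iffD1] DERIV_cmult S_Suc_deriv)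
      have "norm (P t *\<^sub>R (- \<mu> * (sol \<mu> t - of_real (cosh (t / \<rho>))))) =
          norm \<mu> * norm (sol \<mu> t - of_real (cosh (t / \<rho>))) * (P t * 1)"
        using P_nonneg[of t] \<open>0 < t\<close> by (simp add: norm_mult)
      also have "\<dots> \<le> norm \<mu> * e' * (P t * cosh (t / \<rho>))"
        using d[of t] P_nonneg[of t] \<open>0 < t\<close> \<open>t < r\<close> \<open>r < d\<close> \<open>e' > 0\<close>
        by (intro mult_mono) (auto simp: cosh_real_ge_1 less_imp_le intro!: mult_nonneg_nonneg)
      finally show "norm (P t *\<^sub>R (- \<mu> * (sol \<mu> t - of_real (cosh (t / \<rho>))))) \<le>
          norm \<mu> * e' * (P t * cosh (t / \<rho>))" .
    qed (auto intro!: continuous_intros)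
    then have "norm (H r) \<le> norm \<mu> * e' * (?c * (P r * S r))"
      by (simp add: H_def P_def mult.commute)
    moreover have "H r = of_real (P r * S r) * (sol_deriv \<mu> r / of_real (S r) - (- \<mu> * of_real ?c))"
      using S_pos[OF r(1)] by (simp add: H_def P_def scaleR_conv_of_real field_simps)
    ultimately have "P r * S r * dist (sol_deriv \<mu> r / of_real (S r)) (- \<mu> * of_real ?c) \<le>
        P r * S r * (norm \<mu> * e' * ?c)"
      using S_pos[OF r(1)] P_pos[OF r(1)] by (simp add: norm_mult dist_norm mult_ac)
    then have "dist (sol_deriv \<mu> r / of_real (S r)) (- \<mu> * of_real ?c) \<le> norm \<mu> * e' * ?c"
      by (rule mult_left_le_imp_le) (use S_pos[OF r(1)] P_pos[OF r(1)] in simp)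
    also have "\<dots> \<le> norm \<mu> * e' * \<rho>"
      using \<open>e' > 0\<close> rho_pos by (intro mult_left_mono) (auto simp: divide_le_eq)
    also have "\<dots> = e * (norm \<mu> / (norm \<mu> + 1))"
      using rho_pos by (simp add: e'_def)
    also have "\<dots> < e * 1"
      using \<open>e > 0\<close> by (intro mult_strict_left_mono) (auto simp: divide_less_eq add_nonneg_pos)
    finally show ?thesis by simp
  qed
  then show "\<forall>\<^sub>F r in at_right 0. dist (sol_deriv \<mu> r / of_real (S r)) (- \<mu> * of_real ?c) < e"
    using \<open>d > 0\<close> by (auto simp: eventually_at_right)
qed

text \<open>Equal functions have equal derivatives, and \<open>\<mu>\<close> can be read off from
  the limit of \<open>sol_deriv / S\<close> at 0.\<close>

lemma sol_inj:
  assumes "\<And>r. r > 0 \<Longrightarrow> sol \<mu> r = sol \<nu> r"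
  shows "\<mu> = \<nu>"
proof -
  have eq: "sol_deriv \<mu> r = sol_deriv \<nu> r" if "r > 0" for r
  proof (rule vector_derivative_unique_at)
    show "(sol \<mu> has_vector_derivative sol_deriv \<mu> r) (at r)"
      using ode_sol that by (auto simp: ode_def)
    have "(sol \<nu> has_vector_derivative sol_deriv \<nu> r) (at r)"
      using ode_sol that by (auto simp: ode_def)
    then show "(sol \<mu> has_vector_derivative sol_deriv \<nu> r) (at r)"
      by (rule has_vector_derivative_transform_within_open[of _ _ _ "{0<..}"]) (use that assms in auto)
  qed
  have "- \<mu> * of_real (\<rho> / real (Suc k)) = - \<nu> * of_real (\<rho> / real (Suc k))"
  proof (rule tendsto_unique[OF _ sol_deriv_over_S_tendsto])
    show "((\<lambda>r. sol_deriv \<mu> r / of_real (S r)) \<longlongrightarrow> - \<nu> * of_real (\<rho> / real (Suc k))) (at_right 0)"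
      by (rule Lim_transform_eventually[OF sol_deriv_over_S_tendsto])
        (auto simp: eventually_at_right_field eq intro!: exI[of _ 1])
  qed simp
  then show ?thesis using rho_pos by (simp del: of_nat_Suc)
qed

end

section \<open>Comparison with supersolutions\<close>

context hyperbolic
begin

text \<open>Sturm comparison: the Wronskian \<open>P (u' w - u w')\<close> vanishes at 0 and increases as long as
  \<open>u > 0\<close>, so that \<open>u / w\<close> increases and \<open>u\<close> cannot reach 0.\<close>

lemma supersolution_comparison:
  assumes "k > 0"
    and u: "\<And>r. r > 0 \<Longrightarrow> (u has_real_derivative u' r) (at r)"
      "\<And>r. r > 0 \<Longrightarrow> (u' has_real_derivative - coth_coeff r * u' r - m * u r) (at r)"
      "continuous_on {0..} u" "continuous_on {0..} u'" "u 0 > 0"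
    and w: "\<And>r. r > 0 \<Longrightarrow> (w has_real_derivative w' r) (at r)"
      "\<And>r. r > 0 \<Longrightarrow> (w' has_real_derivative w'' r) (at r)"
      "continuous_on {0..} w" "continuous_on {0..} w'" "\<And>r. r \<ge> 0 \<Longrightarrow> w r > 0"
      "\<And>r. r > 0 \<Longrightarrow> w'' r + coth_coeff r * w' r + m * w r < 0"
    and "r > 0"
  shows "u r / w r > u 0 / w 0"
proof -
  \<comment> \<open>Positivity of \<open>u\<close> is asked only before \<open>R\<close>, so that
    \<open>R\<close> may later be the first zero of \<open>u\<close>.\<close>
  have mono: "u R / w R > u 0 / w 0" if "R > 0" and pos: "\<And>t. 0 \<le> t \<Longrightarrow> t < R \<Longrightarrow> u t > 0" for R
  proof -
    define D where "D t = P t * (u' t * w t - u t * w' t)" for t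
    have D_pos: "D t > 0" if "0 < t" "t < R" for t
    proof -
      have "D 0 < D t"
      proof (rule DERIV_pos_imp_increasing_open[OF \<open>0 < t\<close>])
        fix s assume s: "0 < s" "s < t"
        \<comment> \<open>The terms in \<open>u'\<close> cancel, and what is left is
          \<open>- P * u\<close> times the expression that is negative for a supersolution.\<close>
        have "(D has_real_derivative - P s * u s * (w'' s + coth_coeff s * w' s + m * w s)) (at s)"
          unfolding D_def
          by (rule derivative_eq_intros P_deriv[OF s(1)] u(1,2)[OF s(1)] w(1,2)[OF s(1)] refl)+
            (simp add: algebra_simps)
        moreover have "- P s * u s * (w'' s + coth_coeff s * w' s + m * w s) > 0"
          using P_pos[OF s(1)] pos[of s] w(6)[OF s(1)] s that
          by (simp add: mult_pos_neg)
        ultimately show "\<exists>y. (D has_real_derivative y) (at s) \<and> y > 0" by blast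
      next
        show "continuous_on {0..t} D"
          unfolding D_def by (intro continuous_intros continuous_on_subset[OF u(3)]
            continuous_on_subset[OF u(4)] continuous_on_subset[OF w(3)] continuous_on_subset[OF w(4)]) auto
      qed
      moreover have "D 0 = 0" using \<open>k > 0\<close> by (simp add: D_def P_def)
      ultimately show ?thesis by simp
    qed
    show ?thesis
    proof (rule DERIV_pos_imp_increasing_open[OF \<open>R > 0\<close>, where f = "\<lambda>t. u t / w t"])
      fix t assume t: "0 < t" "t < R"
      have "((\<lambda>t. u t / w t) has_real_derivative (u' t * w t - u t * w' t) / (w t * w t)) (at t)"
        using w(5)[of t] t by (intro DERIV_divide u w) auto
      moreover have "u' t * w t - u t * w' t > 0"
        using D_pos[OF t] P_pos[OF t(1)] by (simp add: D_def zero_less_mult_iff)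
      ultimately show "\<exists>y. ((\<lambda>t. u t / w t) has_real_derivative y) (at t) \<and> y > 0"
        using w(5)[of t] t by (meson divide_pos_pos less_imp_le mult_pos_pos)
    next
      show "continuous_on {0..R} (\<lambda>t. u t / w t)"
        using w(5) by (intro continuous_intros continuous_on_subset[OF u(3)] continuous_on_subset[OF w(3)])
          (auto simp: less_imp_neq[symmetric])
    qed
  qed
  have u_pos: "u t > 0" if "t \<ge> 0" for t
  proof (rule ccontr)
    assume "\<not> u t > 0"
    define Z where "Z = {t \<in> {0..}. u t \<le> 0}"
    \<comment> \<open>The first zero: there \<open>u / w\<close> would be at most 0, yet by
      \<open>mono\<close> exceed the positive number \<open>u 0 / w 0\<close>.\<close>
    define z where "z = Inf Z"
    have "closed Z"
      unfolding Z_def by (intro continuous_on_closed_Collect_le u(3) continuous_intros closed_atLeast)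
    moreover have "Z \<noteq> {}" using that \<open>\<not> u t > 0\<close> by (auto simp: Z_def)
    moreover have bdd: "bdd_below Z" by (auto simp: Z_def intro: bdd_belowI[of _ 0])
    ultimately have "z \<in> Z" unfolding z_def by (intro closed_contains_Inf)
    then have "z \<noteq> 0" "z \<ge> 0" "u z \<le> 0" using u(5) by (auto simp: Z_def)
    then have "z > 0" by simp
    have "u s > 0" if "0 \<le> s" "s < z" for s
      using cInf_lower[OF _ bdd, of s] that by (force simp: Z_def z_def)
    then have "u z / w z > u 0 / w 0" using mono[OF \<open>z > 0\<close>] by blast
    moreover have "u 0 / w 0 > 0" using u(5) w(5)[of 0] by simp
    moreover have "u z / w z \<le> 0"
      using w(5)[of z] \<open>z \<ge> 0\<close> \<open>u z \<le> 0\<close> by (simp add: divide_le_0_iff)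
    ultimately show False by simp
  qed
  show ?thesis using mono[OF \<open>r > 0\<close>] u_pos by blast
qed

lemma Re_sol_ode:
  assumes "r > 0"
  shows "((\<lambda>r. Re (sol (of_real m) r)) has_real_derivative Re (sol_deriv (of_real m) r)) (at r)"
    and "((\<lambda>r. Re (sol_deriv (of_real m) r)) has_real_derivative
      - coth_coeff r * Re (sol_deriv (of_real m) r) - m * Re (sol (of_real m) r)) (at r)"
  using ode_sol[of "of_real m"] assms
  by (auto simp: ode_def has_real_derivative_iff_has_vector_derivative
      dest!: spec[of _ r] bounded_linear.has_vector_derivative[OF bounded_linear_Re])

lemma continuous_on_Re_sol:
  "continuous_on {0..} (\<lambda>r. Re (sol \<mu> r))" "continuous_on {0..} (\<lambda>r. Re (sol_deriv \<mu> r))"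
  by (intro continuous_intros continuous_on_sol continuous_on_sol_deriv)+

text \<open>At the bottom of the spectrum \<open>exp (- k r / (2 \<rho>))\<close> is a supersolution because \<open>coth > 1\<close>.\<close>

lemma Re_sol_pos:
  assumes "k > 0" "m \<le> (real k)\<^sup>2 / (4 * \<rho>\<^sup>2)" "r \<ge> 0"
  shows "Re (sol (of_real m) r) > 0"
proof (cases "r = 0")
  case False
  \<comment> \<open>With \<open>coth\<close> replaced by its lower bound 1, the expression for
    \<open>exp (- c * r)\<close> is \<open>c\<^sup>2 - (k / \<rho>) * c + m\<close> times the
    exponential. This \<open>c\<close> minimizes the quadratic, with minimum
    \<open>m - c\<^sup>2\<close>; the hypothesis on \<open>m\<close> says that it is at most
    0.\<close>
  define c where "c = real k / (2 * \<rho>)"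
  have "c > 0" using assms(1) rho_pos by (simp add: c_def)
  have "m \<le> c\<^sup>2" using assms(2) by (simp add: c_def power_divide power_mult_distrib)
  define w where "w r = exp (- c * r)" for r
  have "Re (sol (of_real m) r) / w r > Re (sol (of_real m) 0) / w 0"
  proof (rule supersolution_comparison[OF assms(1) Re_sol_ode continuous_on_Re_sol,
        where w' = "\<lambda>r. - c * w r" and w'' = "\<lambda>r. c\<^sup>2 * w r"])
    fix t :: real assume "t > 0"
    have "sinh (t / \<rho>) > 0" using \<open>t > 0\<close> rho_pos by simp
    moreover have "sinh (t / \<rho>) < cosh (t / \<rho>)" by (rule sinh_less_cosh_real)
    ultimately have "1 < cosh (t / \<rho>) / sinh (t / \<rho>)" by simp
    then have "2 * c * 1 < 2 * c * (cosh (t / \<rho>) / sinh (t / \<rho>))"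
      using \<open>c > 0\<close> by (intro mult_strict_left_mono) auto
    then have "2 * c < coth_coeff t" by (simp add: coth_coeff_def c_def)
    then have "2 * c * c < coth_coeff t * c" using \<open>c > 0\<close> by (intro mult_strict_right_mono)
    then have "c\<^sup>2 - coth_coeff t * c + m < 0" using \<open>m \<le> c\<^sup>2\<close> by (simp add: power2_eq_square)
    then have "(c\<^sup>2 - coth_coeff t * c + m) * w t < 0"
      by (simp add: w_def mult_less_0_iff)
    then show "c\<^sup>2 * w t + coth_coeff t * (- c * w t) + m * w t < 0"
      by (simp add: algebra_simps)
    show "(w has_real_derivative - c * w t) (at t)"
      "((\<lambda>r. - c * w r) has_real_derivative c\<^sup>2 * w t) (at t)"
      unfolding w_def by (auto intro!: derivative_eq_intros simp: power2_eq_square)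
  qed (use False assms in \<open>auto simp: w_def intro!: continuous_intros\<close>)
  then have "Re (sol (of_real m) r) / w r > 1" by (simp add: w_def)
  then have "Re (sol (of_real m) r) / w r > 0" by linarith
  then show ?thesis by (simp add: w_def zero_less_divide_iff)
qed simp

text \<open>The eigenfunction of the larger parameter \<open>m'\<close> is positive and is a strict
  supersolution for \<open>m\<close>: substituting it leaves \<open>(m - m')\<close> times itself.
  Both functions start at 1, so the quotient exceeds 1 for \<open>r > 0\<close>.\<close>

lemma Re_sol_strict_antimono:
  assumes "k > 0" "m < m'" "m' \<le> (real k)\<^sup>2 / (4 * \<rho>\<^sup>2)" "r > 0"
  shows "Re (sol (of_real m') r) < Re (sol (of_real m) r)"
proof -
  let ?w = "\<lambda>r. Re (sol (of_real m') r)" and ?w' = "\<lambda>r. Re (sol_deriv (of_real m') r)"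
  have w_pos: "?w t > 0" if "t \<ge> 0" for t
    using Re_sol_pos[OF assms(1,3) that] .
  have "Re (sol (of_real m) r) / ?w r > Re (sol (of_real m) 0) / ?w 0"
  proof (rule supersolution_comparison[OF assms(1) Re_sol_ode continuous_on_Re_sol _ Re_sol_ode continuous_on_Re_sol])
    fix t :: real assume "t > 0"
    have "(m - m') * ?w t < 0" using w_pos[of t] \<open>t > 0\<close> assms(2) by (simp add: mult_neg_pos)
    then show "- coth_coeff t * ?w' t - m' * ?w t + coth_coeff t * ?w' t + m * ?w t < 0"
      by (simp add: algebra_simps)
  qed (use w_pos assms in auto)
  then show ?thesis using w_pos[of r] \<open>r > 0\<close> by (simp add: less_divide_eq)
qed

end

section \<open>Smooth radial functions on the ball\<close>

lemma twice_continuously_differentiable_on_cong: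
  assumes "\<And>x. x \<in> X \<Longrightarrow> f x = g x"
  shows "f twice_continuously_differentiable_on X \<longleftrightarrow> g twice_continuously_differentiable_on X"
proof -
  have "(f has_derivative D) (at x within X) \<longleftrightarrow> (g has_derivative D) (at x within X)" if "x \<in> X" for D x
    using assms that has_derivative_transform by metis
  then show ?thesis unfolding twice_continuously_differentiable_on_def by meson
qed

text \<open>The rank-one map given by \<open>c\<close> and \<open>v\<close>, bundled as a bounded
  linear map since the first derivative must itself be differentiated. Being bilinear in
  \<open>c\<close> and \<open>v\<close>, it obeys the product rule.\<close>

definition radial_blinfun ::
    "'b::real_normed_vector \<Rightarrow> 'a::real_inner \<Rightarrow> 'a \<Rightarrow>\<^sub>L 'b" where
  "radial_blinfun c v = blinfun_scaleR_left c o\<^sub>L blinfun_inner_right v"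

lemma radial_blinfun_apply [simp]: "radial_blinfun c v w = (v \<bullet> w) *\<^sub>R c"
  by (simp add: radial_blinfun_def)

lemma norm_radial_blinfun_le: "norm (radial_blinfun c v) \<le> norm c * norm v"
proof (rule norm_blinfun_bound)
  fix w
  have "norm (radial_blinfun c v w) = norm c * \<bar>v \<bullet> w\<bar>" by simp
  also have "\<dots> \<le> norm c * (norm v * norm w)"
    by (intro mult_left_mono Cauchy_Schwarz_ineq2) auto
  finally show "norm (radial_blinfun c v w) \<le> norm c * norm v * norm w" by (simp add: mult.assoc)
qed simp

lemma bounded_bilinear_radial_blinfun: "bounded_bilinear radial_blinfun"
proof
  show "\<exists>K. \<forall>c v. norm (radial_blinfun c v) \<le> norm c * norm v * K"
    using norm_radial_blinfun_le by (intro exI[of _ 1]) auto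
qed (auto intro!: blinfun_eqI simp: algebra_simps blinfun.bilinear_simps)

text \<open>Here \<open>\<alpha> = g' / t\<close> and \<open>\<beta> = t * \<alpha>'\<close>. The
  first derivative is \<open>\<alpha> (norm x)\<close> paired with \<open>x\<close>, the second is
  \<open>\<alpha> (norm x)\<close> times the inner product plus \<open>\<beta> (norm x)\<close>
  times the projection onto the direction of \<open>x\<close>. Apart from the bounded
  \<open>sgn x\<close>, no division by \<open>norm x\<close> remains.\<close>

lemma twice_continuously_differentiable_radial:
  fixes g \<alpha> \<beta> :: "real \<Rightarrow> 'b::real_normed_vector"
  assumes g: "\<And>t. 0 < t \<Longrightarrow> t < 1 \<Longrightarrow> (g has_vector_derivative t *\<^sub>R \<alpha> t) (at t)"
    and \<alpha>: "\<And>t. 0 < t \<Longrightarrow> t < 1 \<Longrightarrow> (\<alpha> has_vector_derivative \<beta> t /\<^sub>R t) (at t)"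
    and cont: "continuous_on {0..<1} g" "continuous_on {0..<1} \<alpha>" "continuous_on {0..<1} \<beta>"
    and "\<beta> 0 = 0"
  shows "(\<lambda>x::'a::euclidean_space. g (norm x)) twice_continuously_differentiable_on ball 0 1"
proof -
  interpret bounded_bilinear "radial_blinfun :: 'b \<Rightarrow> 'a \<Rightarrow> _"
    by (rule bounded_bilinear_radial_blinfun)
  define f' where "f' x = radial_blinfun (\<alpha> (norm x)) x" for x :: 'a
  define h where "h x v = radial_blinfun (\<alpha> (norm x)) v + (sgn x \<bullet> v) *\<^sub>R radial_blinfun (\<beta> (norm x)) (sgn x)"
    for x v :: 'a
  have h_linear: "bounded_linear (h x)" for x
    unfolding h_def
    by (intro bounded_linear_add bounded_linear_right bounded_linear_scaleR_const bounded_linear_inner_right)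
  define f'' where "f'' x = Blinfun (h x)" for x
  have f''_apply: "blinfun_apply (f'' x) = h x" for x
    unfolding f''_def by (rule bounded_linear_Blinfun_apply[OF h_linear])
  have norm_cont: "continuous_on (ball 0 1) (\<lambda>x::'a. u (norm x))"
    if "continuous_on {0..<1} u" for u :: "real \<Rightarrow> 'b"
    by (rule continuous_on_compose2[OF that]) (auto intro!: continuous_intros)
  have norm_deriv: "(norm has_derivative (\<lambda>v. sgn x \<bullet> v)) (at x)" if "x \<noteq> 0" for x :: 'a
    using has_derivative_norm[OF that] by (simp add: inner_commute)
  have "((\<lambda>x::'a. g (norm x)) has_derivative blinfun_apply (f' x)) (at x)" if x: "x \<in> ball 0 1" for x
  proof (cases "x = 0")
    case False
    with x have "((g \<circ> norm) has_derivative (\<lambda>s. s *\<^sub>R norm x *\<^sub>R \<alpha> (norm x)) \<circ> (\<lambda>v. sgn x \<bullet> v)) (at x)"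
      by (intro diff_chain_at norm_deriv) (use g[of "norm x"] in \<open>auto simp: has_vector_derivative_def\<close>)
    moreover have "(\<lambda>s. s *\<^sub>R norm x *\<^sub>R \<alpha> (norm x)) \<circ> (\<lambda>v. sgn x \<bullet> v) = blinfun_apply (f' x)"
      using False by (auto simp: f'_def sgn_div_norm)
    ultimately show ?thesis by (simp add: o_def)
  next
    case True
    have "bounded (\<alpha> ` {0..1/2})"
      by (intro compact_imp_bounded compact_continuous_image continuous_on_subset[OF cont(2)]) auto
    then obtain A where A: "\<And>t. 0 \<le> t \<Longrightarrow> t \<le> 1/2 \<Longrightarrow> norm (\<alpha> t) \<le> A"
      unfolding bounded_iff by (metis atLeastAtMost_iff imageI)
    \<comment> \<open>As \<open>g'\<close> is \<open>t\<close> times a bounded function near 0,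
      \<open>g\<close> differs from \<open>g 0\<close> only quadratically, so the derivative at the
      centre is 0.\<close>
    have quad: "norm (g t - g 0) \<le> A * (t ^ 2 / 2)" if "0 < t" "t \<le> 1/2" for t
    proof -
      have "norm (g t - g 0) \<le> A * (t ^ Suc 1 / fact (Suc 1))"
      proof (rule norm_le_power_if_deriv_le[OF that(1)])
        fix s assume s: "0 < s" "s < t"
        show "((\<lambda>t. g t - g 0) has_vector_derivative s *\<^sub>R \<alpha> s) (at s)"
          using has_vector_derivative_diff[OF g has_vector_derivative_const, of s "g 0"] s that by simp
        show "norm (s *\<^sub>R \<alpha> s) \<le> A * (s ^ 1 / fact 1)"
          using A[of s] s that by (simp add: mult.commute mult_left_mono)
      qed (use that in \<open>auto intro!: continuous_intros continuous_on_subset[OF cont(1)]\<close>)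
      then show ?thesis by (simp add: power2_eq_square)
    qed
    have "((\<lambda>x::'a. g (norm x)) has_derivative (\<lambda>v. 0)) (at 0)"
      unfolding has_derivative_at
    proof (rule conjI[OF bounded_linear_zero Lim_null_comparison])
      have "\<forall>\<^sub>F v::'a in at 0. v \<noteq> 0 \<and> norm v < 1/2"
        unfolding eventually_at by (intro exI[of _ "1/2"]) auto
      then show "\<forall>\<^sub>F v::'a in at 0. norm (norm (g (norm (0 + v)) - g (norm (0::'a)) - 0) / norm v) \<le> A / 2 * norm v"
      proof eventually_elim
        case (elim v)
        then show ?case
          using quad[of "norm v"] by (simp add: divide_le_eq power2_eq_square)
      qed
      have "((\<lambda>v::'a. A / 2 * norm v) \<longlongrightarrow> A / 2 * norm (0::'a)) (at 0)" by (intro tendsto_intros)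
      then show "((\<lambda>v::'a. A / 2 * norm v) \<longlongrightarrow> 0) (at 0)" by simp
    qed
    moreover have "blinfun_apply (f' 0) = (\<lambda>v. 0)" by (simp add: f'_def fun_eq_iff)
    ultimately show ?thesis using True by simp
  qed
  moreover have "(f' has_derivative blinfun_apply (f'' x)) (at x)" if x: "x \<in> ball 0 1" for x
  proof (cases "x = 0")
    case False
    with x have "((\<alpha> \<circ> norm) has_derivative (\<lambda>s. s *\<^sub>R (\<beta> (norm x) /\<^sub>R norm x)) \<circ> (\<lambda>v. sgn x \<bullet> v)) (at x)"
      by (intro diff_chain_at norm_deriv) (use \<alpha>[of "norm x"] in \<open>auto simp: has_vector_derivative_def\<close>)
    then have "((\<lambda>x. \<alpha> (norm x)) has_derivative (\<lambda>v. (sgn x \<bullet> v) *\<^sub>R (\<beta> (norm x) /\<^sub>R norm x))) (at x)"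
      by (simp add: o_def)
    from FDERIV[OF this has_derivative_ident]
    have "(f' has_derivative (\<lambda>v. radial_blinfun (\<alpha> (norm x)) v +
        radial_blinfun ((sgn x \<bullet> v) *\<^sub>R (\<beta> (norm x) /\<^sub>R norm x)) x)) (at x)"
      unfolding f'_def .
    moreover have "(\<lambda>v. radial_blinfun (\<alpha> (norm x)) v +
        radial_blinfun ((sgn x \<bullet> v) *\<^sub>R (\<beta> (norm x) /\<^sub>R norm x)) x) = h x"
      by (auto simp: h_def scaleR_left scaleR_right sgn_div_norm)
    ultimately show ?thesis by (simp add: f''_apply)
  next
    case True
    have "(f' has_derivative radial_blinfun (\<alpha> 0)) (at 0)"
      unfolding has_derivative_at
    proof (rule conjI[OF bounded_linear_right Lim_null_comparison[OF always_eventually]], rule allI)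
      fix v :: 'a
      have "norm (f' (0 + v) - f' 0 - radial_blinfun (\<alpha> 0) v) \<le> norm (\<alpha> (norm v) - \<alpha> 0) * norm v"
        using norm_radial_blinfun_le[of "\<alpha> (norm v) - \<alpha> 0" v] by (simp add: f'_def diff_left zero_right)
      then show "norm (norm (f' (0 + v) - f' 0 - radial_blinfun (\<alpha> 0) v) / norm v) \<le> norm (\<alpha> (norm v) - \<alpha> 0)"
        by (simp add: divide_le_eq)
    next
      have "isCont (\<lambda>x::'a. \<alpha> (norm x)) 0"
        using norm_cont[OF cont(2)] by (simp add: continuous_on_eq_continuous_at)
      then have "((\<lambda>x::'a. \<alpha> (norm x)) \<longlongrightarrow> \<alpha> 0) (at 0)" by (simp add: isCont_def)
      then show "((\<lambda>v::'a. norm (\<alpha> (norm v) - \<alpha> 0)) \<longlongrightarrow> 0) (at 0)"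
        by (intro tendsto_norm_zero) (simp add: LIM_zero)
    qed
    moreover have "h 0 = radial_blinfun (\<alpha> 0)" by (simp add: h_def fun_eq_iff)
    ultimately show ?thesis using True by (simp add: f''_apply)
  qed
  moreover have "continuous_on (ball 0 1) f''"
  proof (rule continuous_on_blinfun_componentwise)
    fix i :: 'a assume "i \<in> Basis"
    have "isCont (\<lambda>x. (sgn x \<bullet> i) *\<^sub>R radial_blinfun (\<beta> (norm x)) (sgn x)) x" if x: "x \<in> ball 0 1" for x
    proof -
      have \<beta>_cont: "isCont (\<lambda>x::'a. \<beta> (norm x)) x"
        using norm_cont[OF cont(3)] x by (simp add: continuous_on_eq_continuous_at)
      show ?thesis
      proof (cases "x = 0")
        case False
        then have "isCont sgn x" by (intro continuous_intros) auto
        then show ?thesis using False by (intro continuous_intros continuous \<beta>_cont) auto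
      next
        case True
        \<comment> \<open>The direction \<open>sgn x\<close> has no limit at 0, but it is bounded
          and the factor \<open>\<beta>\<close> tends to \<open>\<beta> 0 = 0\<close>.\<close>
        have "((\<lambda>x. (sgn x \<bullet> i) *\<^sub>R radial_blinfun (\<beta> (norm x)) (sgn x)) \<longlongrightarrow> 0) (at 0)"
        proof (rule Lim_null_comparison[OF always_eventually], rule allI)
          fix x :: 'a
          have "\<bar>sgn x \<bullet> i\<bar> \<le> 1"
            using Cauchy_Schwarz_ineq2[of "sgn x" i] \<open>i \<in> Basis\<close> by (simp add: norm_sgn split: if_splits)
          moreover have "norm (radial_blinfun (\<beta> (norm x)) (sgn x)) \<le> norm (\<beta> (norm x))"
            using norm_radial_blinfun_le[of "\<beta> (norm x)" "sgn x"] by (simp add: norm_sgn split: if_splits)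
          ultimately show "norm ((sgn x \<bullet> i) *\<^sub>R radial_blinfun (\<beta> (norm x)) (sgn x)) \<le> norm (\<beta> (norm x))"
            using mult_mono[of "\<bar>sgn x \<bullet> i\<bar>" 1 "norm (radial_blinfun (\<beta> (norm x)) (sgn x))" "norm (\<beta> (norm x))"]
            by simp
        next
          show "((\<lambda>x::'a. norm (\<beta> (norm x))) \<longlongrightarrow> 0) (at 0)"
            using \<beta>_cont True \<open>\<beta> 0 = 0\<close> by (intro tendsto_norm_zero) (simp add: isCont_def)
        qed
        then show ?thesis using True by (simp add: isCont_def)
      qed
    qed
    then have "continuous_on (ball 0 1) (\<lambda>x. (sgn x \<bullet> i) *\<^sub>R radial_blinfun (\<beta> (norm x)) (sgn x))"
      by (intro continuous_at_imp_continuous_on) blast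
    then show "continuous_on (ball 0 1) (\<lambda>x. blinfun_apply (f'' x) i)"
      unfolding f''_apply h_def by (intro continuous_on_add continuous_on norm_cont cont continuous_on_const)
  qed
  ultimately show ?thesis
    unfolding twice_continuously_differentiable_on_def
    by (intro exI[of _ f'] exI[of _ f''] conjI ballI) (auto intro: has_derivative_at_withinI)
qed

section \<open>Radial eigenfunctions\<close>

lemma exp_double_artanh:
  fixes t :: real
  assumes "\<bar>t\<bar> < 1"
  shows "exp (2 * artanh t) = (1 + t) / (1 - t)"
  using assms by (simp add: artanh_def abs_less_iff)

text \<open>Expresses \<open>S\<close> at hyperbolic radius \<open>2 * \<rho> * artanh t\<close> as
  a rational function of the Euclidean norm \<open>t\<close>.\<close>

lemma sinh_double_artanh:
  fixes t :: real
  assumes "\<bar>t\<bar> < 1"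
  shows "sinh (2 * artanh t) = 2 * t / (1 - t\<^sup>2)"
proof -
  have nz: "1 + t \<noteq> 0" "1 - t \<noteq> 0" using assms by auto
  have "sinh (2 * artanh t) = ((1 + t) / (1 - t) - (1 - t) / (1 + t)) / 2"
    unfolding sinh_field_def exp_minus exp_double_artanh[OF assms] by simp
  also have "(1 + t) / (1 - t) - (1 - t) / (1 + t) = ((1 + t) * (1 + t) - (1 - t) * (1 - t)) / ((1 - t) * (1 + t))"
    using nz by (simp add: diff_frac_eq)
  also have "(1 + t) * (1 + t) - (1 - t) * (1 - t) = 4 * t"
    by (simp add: algebra_simps)
  also have "(1 - t) * (1 + t) = 1 - t\<^sup>2"
    by (simp add: power2_eq_square algebra_simps)
  also have "4 * t / x / 2 = 2 * t / x" for x :: real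
    by simp
  finally show ?thesis .
qed

lemma artanh_nonneg: "0 \<le> t \<Longrightarrow> t < 1 \<Longrightarrow> artanh t \<ge> (0 :: real)"
  and artanh_pos: "0 < t \<Longrightarrow> t < 1 \<Longrightarrow> artanh t > (0 :: real)"
  by (simp_all add: artanh_def)

context hyperbolic
begin

text \<open>The value at 0 is the limit, which makes the quotient continuous there. Dividing by
  \<open>S\<close> keeps the later change to the ball coordinate rational.\<close>

definition sol_deriv_quot :: "complex \<Rightarrow> real \<Rightarrow> complex" where
  "sol_deriv_quot \<mu> r = (if r = 0 then - \<mu> * of_real (\<rho> / real (Suc k)) else sol_deriv \<mu> r / of_real (S r))"

text \<open>This is \<open>S\<close> times the derivative of \<open>sol_deriv_quot\<close>. The
  coefficient \<open>Suc k\<close> collects \<open>k\<close> from \<open>coth_coeff\<close> and 1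
  from differentiating \<open>1 / S\<close>; with it the two terms cancel at 0.\<close>

definition defect :: "complex \<Rightarrow> real \<Rightarrow> complex" where
  "defect \<mu> r = - \<mu> * sol \<mu> r - of_real (real (Suc k) / \<rho> * cosh (r / \<rho>)) * sol_deriv_quot \<mu> r"

lemma sol_deriv_eq: "r \<ge> 0 \<Longrightarrow> sol_deriv \<mu> r = S r *\<^sub>R sol_deriv_quot \<mu> r"
  using S_pos[of r] by (cases "r = 0") (auto simp: sol_deriv_quot_def scaleR_conv_of_real)

lemma sol_deriv_quot_deriv:
  assumes "r > 0"
  shows "(sol_deriv_quot \<mu> has_vector_derivative defect \<mu> r /\<^sub>R S r) (at r)"
proof -
  have "S r \<noteq> 0" using S_pos[OF assms] by simp
  have "((\<lambda>r. inverse (S r)) has_real_derivative - (cosh (r / \<rho>) / \<rho> / (S r)\<^sup>2)) (at r)"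
    using DERIV_inverse_fun[OF S_deriv \<open>S r \<noteq> 0\<close>] by (simp add: divide_inverse power2_eq_square mult_ac)
  then have "((\<lambda>r. inverse (S r) *\<^sub>R sol_deriv \<mu> r) has_vector_derivative
      inverse (S r) *\<^sub>R (- of_real (coth_coeff r) * sol_deriv \<mu> r - \<mu> * sol \<mu> r) +
      (- (cosh (r / \<rho>) / \<rho> / (S r)\<^sup>2)) *\<^sub>R sol_deriv \<mu> r) (at r)"
    using ode_sol[of \<mu>] assms by (intro has_vector_derivative_scaleR) (auto simp: ode_def)
  moreover have "inverse (S r) *\<^sub>R (- of_real (coth_coeff r) * sol_deriv \<mu> r - \<mu> * sol \<mu> r) +
      (- (cosh (r / \<rho>) / \<rho> / (S r)\<^sup>2)) *\<^sub>R sol_deriv \<mu> r = defect \<mu> r /\<^sub>R S r"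
    using \<open>S r \<noteq> 0\<close> assms rho_pos unfolding defect_def coth_coeff_def S_def[symmetric] sol_deriv_eq[OF less_imp_le[OF assms]]
    by (simp add: scaleR_conv_of_real field_simps power2_eq_square)
  ultimately have "((\<lambda>r. inverse (S r) *\<^sub>R sol_deriv \<mu> r) has_vector_derivative defect \<mu> r /\<^sub>R S r) (at r)"
    by simp
  then show ?thesis
    by (rule has_vector_derivative_transform_within_open[of _ _ _ "{0<..}"])
      (use assms in \<open>auto simp: sol_deriv_quot_def scaleR_conv_of_real divide_inverse mult.commute\<close>)
qed

lemma continuous_on_sol_deriv_quot: "continuous_on {0..} (sol_deriv_quot \<mu>)"
  unfolding continuous_on_eq_continuous_within
proof
  fix r :: real assume "r \<in> {0..}"
  show "continuous (at r within {0..}) (sol_deriv_quot \<mu>)"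
  proof (cases "r = 0")
    case False
    with \<open>r \<in> _\<close> have "isCont (sol_deriv_quot \<mu>) r"
      using sol_deriv_quot_deriv[of r \<mu>] has_vector_derivative_continuous by force
    then show ?thesis by (rule continuous_at_imp_continuous_within)
  next
    case True
    have "((\<lambda>r. sol_deriv_quot \<mu> r) \<longlongrightarrow> - \<mu> * of_real (\<rho> / real (Suc k))) (at_right 0)"
      by (rule Lim_transform_eventually[OF sol_deriv_over_S_tendsto])
        (auto simp: eventually_at_right_field sol_deriv_quot_def intro!: exI[of _ 1])
    moreover have "at 0 within {0..} = at_right (0 :: real)"
      by (auto simp: at_within_def intro!: arg_cong[of _ _ "\<lambda>X. inf _ (principal X)"])
    moreover have "sol_deriv_quot \<mu> 0 = - \<mu> * of_real (\<rho> / real (Suc k))"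
      by (simp add: sol_deriv_quot_def)
    ultimately show ?thesis using True by (simp only: continuous_within)
  qed
qed

lemma continuous_on_defect: "continuous_on {0..} (defect \<mu>)"
  unfolding defect_def using rho_pos
  by (intro continuous_intros continuous_on_sol continuous_on_sol_deriv_quot) auto

lemma defect_0 [simp]: "defect \<mu> 0 = 0"
  using rho_pos by (simp add: defect_def sol_deriv_quot_def del: of_nat_Suc)

lemma sol_twice_continuously_differentiable:
  "(\<lambda>x::'a::euclidean_space. sol \<mu> (hyp_radius \<rho> x)) twice_continuously_differentiable_on ball 0 1"
proof -
  define R where "R t = 2 * \<rho> * artanh t" for t
  have R_deriv: "(R has_real_derivative 2 * \<rho> / (1 - t\<^sup>2)) (at t)" if "0 < t" "t < 1" for t
    unfolding R_def[abs_def] using that by (auto intro!: derivative_eq_intros)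
  have R_pos: "R t > 0" if "0 < t" "t < 1" for t
    using that rho_pos by (simp add: R_def artanh_pos)
  have R_nonneg: "R t \<ge> 0" if "0 \<le> t" "t < 1" for t
    using that rho_pos by (simp add: R_def artanh_nonneg)
  have S_R: "S (R t) = 2 * t / (1 - t\<^sup>2)" if "0 < t" "t < 1" for t
    using sinh_double_artanh[of t] that rho_pos by (simp add: S_def R_def)
  have nz: "1 - t\<^sup>2 \<noteq> 0" if "0 < t" "t < 1" for t :: real
    using that by (simp add: power2_eq_1_iff)
  have nz0: "1 - t\<^sup>2 \<noteq> 0" if "0 \<le> t" "t < 1" for t :: real
    using that by (simp add: power2_eq_1_iff)
  have R_cont: "continuous_on {0..<1} R"
    unfolding R_def by (intro continuous_intros) auto
  have comp_cont: "continuous_on {0..<1} (\<lambda>t. u (R t))" if "continuous_on {0..} u" for u :: "real \<Rightarrow> complex"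
    by (rule continuous_on_compose2[OF that R_cont]) (auto simp: R_nonneg)
  \<comment> \<open>By the chain rule the derivative of \<open>sol \<mu> (R t)\<close> is
    \<open>2 * \<rho> / (1 - t\<^sup>2)\<close> times \<open>S (R t)\<close> times the quotient; as
    \<open>S (R t) = 2 * t / (1 - t\<^sup>2)\<close>, a factor \<open>t\<close> splits off and
    \<open>\<alpha>\<close> remains.\<close>
  define \<alpha> where "\<alpha> t = (4 * \<rho> / (1 - t\<^sup>2)\<^sup>2) *\<^sub>R sol_deriv_quot \<mu> (R t)" for t
  \<comment> \<open>This is \<open>t * \<alpha>'\<close>: the first term comes from the weight, the
    second from the quotient. Both vanish at 0, the latter because of
    \<open>defect_0\<close>.\<close>
  define \<beta> where "\<beta> t = (16 * \<rho> * t\<^sup>2 / (1 - t\<^sup>2) ^ 3) *\<^sub>R sol_deriv_quot \<mu> (R t) +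
      (4 * \<rho>\<^sup>2 / (1 - t\<^sup>2)\<^sup>2) *\<^sub>R defect \<mu> (R t)" for t
  have "(\<lambda>x::'a. sol \<mu> (R (norm x))) twice_continuously_differentiable_on ball 0 1"
  proof (rule twice_continuously_differentiable_radial[where \<alpha> = \<alpha> and \<beta> = \<beta>])
    fix t :: real assume t: "0 < t" "t < 1"
    have "((sol \<mu> \<circ> R) has_vector_derivative (2 * \<rho> / (1 - t\<^sup>2)) *\<^sub>R sol_deriv \<mu> (R t)) (at t)"
      using R_deriv[OF t] ode_sol[of \<mu>] R_pos[OF t]
      by (intro vector_diff_chain_at) (auto simp: ode_def has_real_derivative_iff_has_vector_derivative)
    moreover have "(2 * \<rho> / (1 - t\<^sup>2)) *\<^sub>R sol_deriv \<mu> (R t) = t *\<^sub>R \<alpha> t"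
      using R_nonneg[of t] t nz[OF t]
      by (simp add: sol_deriv_eq S_R \<alpha>_def power2_eq_square mult_ac)
    ultimately show "((\<lambda>t. sol \<mu> (R t)) has_vector_derivative t *\<^sub>R \<alpha> t) (at t)"
      by (simp add: o_def)
    have "((sol_deriv_quot \<mu> \<circ> R) has_vector_derivative
        (2 * \<rho> / (1 - t\<^sup>2)) *\<^sub>R (defect \<mu> (R t) /\<^sub>R S (R t))) (at t)"
      using R_deriv[OF t] sol_deriv_quot_deriv[OF R_pos[OF t]]
      by (intro vector_diff_chain_at) (auto simp: has_real_derivative_iff_has_vector_derivative)
    moreover have "(2 * \<rho> / (1 - t\<^sup>2)) *\<^sub>R (defect \<mu> (R t) /\<^sub>R S (R t)) = (\<rho> / t) *\<^sub>R defect \<mu> (R t)"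
      using t nz[OF t] by (simp add: S_R)
    ultimately have Q: "((\<lambda>t. sol_deriv_quot \<mu> (R t)) has_vector_derivative (\<rho> / t) *\<^sub>R defect \<mu> (R t)) (at t)"
      by (simp only: o_def)
    have "((\<lambda>t. 4 * \<rho> / (1 - t\<^sup>2)\<^sup>2) has_real_derivative 16 * \<rho> * t / (1 - t\<^sup>2) ^ 3) (at t)"
    proof -
      have "((\<lambda>t. (1 - t\<^sup>2)\<^sup>2) has_real_derivative 2 * (1 - t\<^sup>2) * (- 2 * t)) (at t)"
        by (auto intro!: derivative_eq_intros)
      then have "((\<lambda>t. 4 * \<rho> * inverse ((1 - t\<^sup>2)\<^sup>2)) has_real_derivative 4 * \<rho> *
          - (inverse ((1 - t\<^sup>2)\<^sup>2) * (2 * (1 - t\<^sup>2) * (- 2 * t)) * inverse ((1 - t\<^sup>2)\<^sup>2))) (at t)"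
        by (intro DERIV_cmult DERIV_inverse') (use nz[OF t] in simp_all)
      moreover have "4 * \<rho> * - (inverse (y\<^sup>2) * (2 * y * (- 2 * t)) * inverse (y\<^sup>2)) = 16 * \<rho> * t / y ^ 3"
        if "y \<noteq> 0" for y
        using that by (simp add: field_simps power2_eq_square power3_eq_cube)
      ultimately show ?thesis using nz[OF t] by (simp only: divide_inverse not_False_eq_True)
    qed
    from has_vector_derivative_scaleR[OF this Q]
    have "(\<alpha> has_vector_derivative (4 * \<rho> / (1 - t\<^sup>2)\<^sup>2) *\<^sub>R (\<rho> / t) *\<^sub>R defect \<mu> (R t) +
        (16 * \<rho> * t / (1 - t\<^sup>2) ^ 3) *\<^sub>R sol_deriv_quot \<mu> (R t)) (at t)"
      unfolding \<alpha>_def[abs_def] .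
    moreover have "(4 * \<rho> / (1 - t\<^sup>2)\<^sup>2) *\<^sub>R (\<rho> / t) *\<^sub>R defect \<mu> (R t) +
        (16 * \<rho> * t / (1 - t\<^sup>2) ^ 3) *\<^sub>R sol_deriv_quot \<mu> (R t) = \<beta> t /\<^sub>R t"
      using t by (simp add: \<beta>_def scaleR_add_right power2_eq_square divide_inverse mult_ac)
    ultimately show "(\<alpha> has_vector_derivative \<beta> t /\<^sub>R t) (at t)" by simp
  next
    show "continuous_on {0..<1} (\<lambda>t. sol \<mu> (R t))"
      by (intro comp_cont continuous_on_sol)
    show "continuous_on {0..<1} \<alpha>" "continuous_on {0..<1} \<beta>"
      unfolding \<alpha>_def \<beta>_def using nz0
      by (intro continuous_intros comp_cont continuous_on_sol_deriv_quot continuous_on_defect; simp)+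
  qed (simp add: \<beta>_def R_def)
  then show ?thesis by (simp add: R_def hyp_radius_def)
qed

section \<open>Identification of the radial eigenfunctions with the power series\<close>

lemma coth_coeff_eq:
  "DIM('a::euclidean_space) = k + 1 \<Longrightarrow>
    real (DIM('a) - 1) / \<rho> * (cosh (r / \<rho>) / sinh (r / \<rho>)) = coth_coeff r"
  by (simp add: coth_coeff_def)

lemma hyp_radius_nonneg: "x \<in> ball 0 1 \<Longrightarrow> hyp_radius \<rho> x \<ge> 0"
  using rho_pos by (simp add: hyp_radius_def artanh_nonneg)

lemma radial_eigenfunction_sol:
  assumes "DIM('a::euclidean_space) = k + 1"
  shows "radial_eigenfunction TYPE('a) \<rho> \<mu> (restrict (sol \<mu>) {0..})"
  unfolding radial_eigenfunction_def
proof (intro conjI exI allI impI)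
  show "(\<lambda>x::'a. restrict (sol \<mu>) {0..} (hyp_radius \<rho> x)) twice_continuously_differentiable_on ball 0 1"
    using sol_twice_continuously_differentiable
    by (subst twice_continuously_differentiable_on_cong) (auto simp: hyp_radius_nonneg)
  fix r :: real assume "r > 0"
  then have ode: "(sol \<mu> has_vector_derivative sol_deriv \<mu> r) (at r)"
      "(sol_deriv \<mu> has_vector_derivative - of_real (coth_coeff r) * sol_deriv \<mu> r - \<mu> * sol \<mu> r) (at r)"
    using ode_sol[of \<mu>] by (auto simp: ode_def)
  show "(restrict (sol \<mu>) {0..} has_vector_derivative sol_deriv \<mu> r) (at r)"
    by (rule has_vector_derivative_transform_within_open[OF ode(1), of "{0<..}"]) (use \<open>r > 0\<close> in auto)
  show "(sol_deriv \<mu> has_vector_derivative - of_real (coth_coeff r) * sol_deriv \<mu> r - \<mu> * sol \<mu> r) (at r)"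
    by (fact ode(2))
  show "- of_real (coth_coeff r) * sol_deriv \<mu> r - \<mu> * sol \<mu> r +
      of_real (real (DIM('a) - 1) / \<rho> * (cosh (r / \<rho>) / sinh (r / \<rho>))) * sol_deriv \<mu> r +
      \<mu> * restrict (sol \<mu>) {0..} r = 0"
    unfolding coth_coeff_eq[OF assms] using \<open>r > 0\<close> by simp
qed simp

text \<open>The equation on \<open>r > 0\<close> alone does not exclude singular solutions.
  Differentiability at the centre of the ball, transported along a ray, makes \<open>\<phi>\<close>
  continuous at 0 and \<open>\<phi>'\<close> bounded near it, which is what
  \<open>ode_unique_zero\<close> needs for the difference with \<open>sol\<close>.\<close>

lemma radial_eigenfunction_unique:
  assumes dim: "DIM('a::euclidean_space) = k + 1" and "k > 0"
    and eig: "radial_eigenfunction TYPE('a) \<rho> \<mu> \<phi>" and "\<phi> 0 = 1"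
  shows "\<phi> = restrict (sol \<mu>) {0..}"
proof -
  obtain \<phi>' where ode: "ode \<mu> \<phi> \<phi>'"
  proof -
    from eig obtain \<phi>' \<phi>'' where d: "\<And>r. r > 0 \<Longrightarrow> (\<phi> has_vector_derivative \<phi>' r) (at r)"
      "\<And>r. r > 0 \<Longrightarrow> (\<phi>' has_vector_derivative \<phi>'' r) (at r)"
      "\<And>r. r > 0 \<Longrightarrow> \<phi>'' r + of_real (coth_coeff r) * \<phi>' r + \<mu> * \<phi> r = 0"
      unfolding radial_eigenfunction_def coth_coeff_eq[OF dim] by auto
    have "ode \<mu> \<phi> \<phi>'"
      unfolding ode_def
    proof (intro allI impI conjI d)
      fix r :: real assume r: "r > 0"
      have "\<phi>'' r = - of_real (coth_coeff r) * \<phi>' r - \<mu> * \<phi> r"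
        using d(3)[OF r] by algebra
      then show "(\<phi>' has_vector_derivative - of_real (coth_coeff r) * \<phi>' r - \<mu> * \<phi> r) (at r)"
        using d(2)[OF r] by simp
    qed
    then show ?thesis by (rule that)
  qed
  define f where "f x = \<phi> (hyp_radius \<rho> x)" for x :: 'a
  from eig obtain f' :: "'a \<Rightarrow> 'a \<Rightarrow>\<^sub>L complex" and f'' where
    f': "\<And>x. x \<in> ball 0 1 \<Longrightarrow> (f has_derivative f' x) (at x within ball 0 1)" and
    f'': "\<And>x. x \<in> ball 0 1 \<Longrightarrow> (f' has_derivative blinfun_apply (f'' x)) (at x within ball 0 1)"
    unfolding radial_eigenfunction_def twice_continuously_differentiable_on_def f_def[abs_def] by blast
  obtain e :: 'a where "e \<in> Basis" using nonempty_Basis by blast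
  then have "norm e = 1" by simp
  \<comment> \<open>The unit-speed geodesic ray from the centre in direction \<open>e\<close>:
    \<open>tanh\<close> inverts \<open>hyp_radius\<close>.\<close>
  define p where "p r = tanh (r / (2 * \<rho>)) *\<^sub>R e" for r
  have p_ball: "p r \<in> ball 0 1" for r
    using \<open>norm e = 1\<close> tanh_real_lt_1[of "r / (2 * \<rho>)"] tanh_real_gt_neg1[of "r / (2 * \<rho>)"]
    by (simp add: p_def abs_less_iff)
  have hyp_radius_p: "hyp_radius \<rho> (p r) = r" if "r \<ge> 0" for r
    using that rho_pos \<open>norm e = 1\<close> by (simp add: hyp_radius_def p_def artanh_tanh_real)
  have \<phi>_eq: "\<phi> r = f (p r)" if "r \<ge> 0" for r
    using hyp_radius_p[OF that] by (simp add: f_def)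
  have p_deriv: "(p has_vector_derivative ((1 - (tanh (r / (2 * \<rho>)))\<^sup>2) / (2 * \<rho>)) *\<^sub>R e) (at r)" for r
  proof -
    have "((\<lambda>r. tanh (r / (2 * \<rho>))) has_real_derivative (1 - (tanh (r / (2 * \<rho>)))\<^sup>2) / (2 * \<rho>)) (at r)"
      using rho_pos by (auto intro!: derivative_eq_intros)
    from has_vector_derivative_scaleR[OF this has_vector_derivative_const[of e]]
    show ?thesis by (simp add: p_def[abs_def])
  qed
  have p_cont: "continuous_on A p" for A
    using p_deriv has_vector_derivative_continuous by (intro continuous_at_imp_continuous_on) blast
  have f_cont: "continuous_on (ball 0 1) f" "continuous_on (ball 0 1) f'"
    using f' f'' has_derivative_continuous unfolding continuous_on_eq_continuous_within by blast+
  have "continuous_on {0..} (\<lambda>r. f (p r))"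
    by (rule continuous_on_compose2[OF f_cont(1) p_cont]) (use p_ball in blast)
  then have \<phi>_cont: "continuous_on {0..} \<phi>"
    using \<phi>_eq continuous_on_cong[OF refl, of "{0..}" \<phi> "\<lambda>r. f (p r)"] by simp
  \<comment> \<open>The given \<open>\<phi>'\<close> is known only for positive \<open>r\<close>;
    there it equals a chain rule expression that stays continuous down to \<open>r = 0\<close>,
    hence bounded.\<close>
  have \<phi>'_eq: "\<phi>' r = ((1 - (tanh (r / (2 * \<rho>)))\<^sup>2) / (2 * \<rho>)) *\<^sub>R f' (p r) e" if "r > 0" for r
  proof (rule vector_derivative_unique_at)
    show "(\<phi> has_vector_derivative \<phi>' r) (at r)" using ode that by (simp add: ode_def)
    have "(f has_derivative f' (p r)) (at (p r))"
      using f'[OF p_ball] p_ball by (metis at_within_open open_ball)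
    from diff_chain_at[OF p_deriv[unfolded has_vector_derivative_def] this]
    have "((\<lambda>r. f (p r)) has_vector_derivative ((1 - (tanh (r / (2 * \<rho>)))\<^sup>2) / (2 * \<rho>)) *\<^sub>R f' (p r) e) (at r)"
      by (simp add: o_def has_vector_derivative_def blinfun.scaleR_right)
    then show "(\<phi> has_vector_derivative ((1 - (tanh (r / (2 * \<rho>)))\<^sup>2) / (2 * \<rho>)) *\<^sub>R f' (p r) e) (at r)"
      by (rule has_vector_derivative_transform_within_open[of _ _ _ "{0<..}"]) (use that \<phi>_eq in auto)
  qed
  have "continuous_on {0..1} (\<lambda>r. ((1 - (tanh (r / (2 * \<rho>)))\<^sup>2) / (2 * \<rho>)) *\<^sub>R f' (p r) e - sol_deriv \<mu> r)"
    using rho_pos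
    by (intro continuous_intros continuous_on_subset[OF continuous_on_sol_deriv]
        continuous_on_compose2[OF f_cont(2) p_cont]) (use p_ball in \<open>auto simp: cosh_real_nonzero\<close>)
  then have "bounded ((\<lambda>r. ((1 - (tanh (r / (2 * \<rho>)))\<^sup>2) / (2 * \<rho>)) *\<^sub>R f' (p r) e - sol_deriv \<mu> r) ` {0..1})"
    by (intro compact_imp_bounded compact_continuous_image) auto
  then obtain B where B: "\<And>r. r \<in> {0..1} \<Longrightarrow>
      norm (((1 - (tanh (r / (2 * \<rho>)))\<^sup>2) / (2 * \<rho>)) *\<^sub>R f' (p r) e - sol_deriv \<mu> r) \<le> B"
    unfolding bounded_iff by blast
  have "\<phi> r - sol \<mu> r = 0" if "r \<ge> 0" for r
  proof (rule ode_unique_zero[OF \<open>k > 0\<close> ode_diff[OF ode ode_sol], where \<delta> = 1 and B = B])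
    show "norm (\<phi>' r - sol_deriv \<mu> r) \<le> B" if "0 < r" "r < 1" for r
      using B[of r] that by (simp add: \<phi>'_eq)
  qed (use that \<open>\<phi> 0 = 1\<close> in \<open>auto intro!: continuous_intros \<phi>_cont continuous_on_sol\<close>)
  moreover have "\<phi> \<in> extensional {0..}" using eig by (simp add: radial_eigenfunction_def)
  ultimately show ?thesis by (auto simp: fun_eq_iff extensional_def)
qed

lemma radial_phi_eq:
  assumes "DIM('a::euclidean_space) = k + 1" "k > 0"
  shows "radial_phi TYPE('a) \<rho> \<mu> = restrict (sol \<mu>) {0..}"
  unfolding radial_phi_def
  using radial_eigenfunction_sol[OF assms(1)] radial_eigenfunction_unique[OF assms]
  by (intro the_equality) auto

lemma radial_phi_inj:
  assumes "DIM('a::euclidean_space) = k + 1" "k > 0"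
    and eq: "radial_phi TYPE('a) \<rho> \<mu> = radial_phi TYPE('a) \<rho> \<nu>"
  shows "\<mu> = \<nu>"
proof (rule sol_inj)
  fix r :: real assume "r > 0"
  then show "sol \<mu> r = sol \<nu> r"
    using fun_cong[OF eq, of r] by (simp add: radial_phi_eq[OF assms(1,2)])
qed

end

theorem corollary3p6:
  fixes k :: nat and \<rho> \<kappa> r0 :: real
    and \<phi> :: "complex \<Rightarrow> real \<Rightarrow> complex" and \<Omega>0 :: "(real \<Rightarrow> complex) set"
  assumes "k \<ge> 1" and "DIM('a::euclidean_space) = k + 1"
    and "\<rho> > 0" and "\<kappa> = - 1 / \<rho>^2"
    and "r0 > 0"
  defines "\<phi> \<equiv> radial_phi TYPE('a) \<rho>"
  defines "\<Omega>0 \<equiv> {\<phi> (of_real \<mu>) | \<mu>::real. \<mu> \<le> - \<kappa> * (real k)^2 / 4}"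
  shows "(\<forall>\<mu> \<mu>' :: complex. \<phi> \<mu> \<in> \<Omega>0 \<longrightarrow> \<phi> \<mu>' \<in> \<Omega>0 \<longrightarrow> \<phi> \<mu> r0 = \<phi> \<mu>' r0 \<longrightarrow>
            \<mu> = \<mu>' \<and> (\<forall>r\<ge>0. \<phi> \<mu> r = \<phi> \<mu>' r)) \<and>
         (\<forall>\<mu> :: complex. \<phi> \<mu> \<in> \<Omega>0 \<longrightarrow>
            infinite {\<psi>. \<psi> \<notin> \<Omega>0 \<and> (\<exists>\<nu> :: complex. \<psi> = \<phi> \<nu>) \<and> \<psi> r0 = \<phi> \<mu> r0})"
proof -
  interpret hyperbolic k \<rho> using assms by unfold_locales
  have "k > 0" using assms by simp
  note dim = \<open>DIM('a) = k + 1\<close>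
  have inj: "\<mu> = \<nu>" if "\<phi> \<mu> = \<phi> \<nu>" for \<mu> \<nu>
    using radial_phi_inj[OF dim \<open>k > 0\<close>] that by (simp add: \<phi>_def)
  have \<phi>_r0: "\<phi> \<mu> r0 = sol \<mu> r0" for \<mu>
    using \<open>r0 > 0\<close> by (simp add: \<phi>_def radial_phi_eq[OF dim \<open>k > 0\<close>])
  have bottom: "- \<kappa> * (real k)\<^sup>2 / 4 = (real k)\<^sup>2 / (4 * \<rho>\<^sup>2)"
    using \<open>\<kappa> = _\<close> by simp
  \<comment> \<open>Membership only says that \<open>\<phi> \<mu>\<close> equals some admissible
    eigenfunction; injectivity is needed to conclude that \<open>\<mu>\<close> itself is
    admissible.\<close>
  have \<Omega>0_D: "\<exists>m. \<mu> = of_real m \<and> m \<le> (real k)\<^sup>2 / (4 * \<rho>\<^sup>2)" if "\<phi> \<mu> \<in> \<Omega>0" for \<mu>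
    using that inj unfolding \<Omega>0_def bottom by blast
  have determined: "\<mu> = \<nu>" if \<mu>\<nu>: "\<phi> \<mu> \<in> \<Omega>0" "\<phi> \<nu> \<in> \<Omega>0" and eq: "\<phi> \<mu> r0 = \<phi> \<nu> r0" for \<mu> \<nu>
  proof -
    obtain m n where mn: "\<mu> = of_real m" "m \<le> (real k)\<^sup>2 / (4 * \<rho>\<^sup>2)"
      "\<nu> = of_real n" "n \<le> (real k)\<^sup>2 / (4 * \<rho>\<^sup>2)"
      using \<Omega>0_D[OF \<mu>\<nu>(1)] \<Omega>0_D[OF \<mu>\<nu>(2)] by blast
    have "Re (sol (of_real m) r0) = Re (sol (of_real n) r0)"
      using eq by (simp add: \<phi>_r0 mn)
    then have "m = n"
      using Re_sol_strict_antimono[OF \<open>k > 0\<close> _ _ \<open>r0 > 0\<close>] mn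
      by (cases m n rule: linorder_cases) force+
    then show ?thesis by (simp add: mn)
  qed
  have "infinite {\<psi>. \<psi> \<notin> \<Omega>0 \<and> (\<exists>\<nu>. \<psi> = \<phi> \<nu>) \<and> \<psi> r0 = \<phi> \<mu> r0}" (is "infinite ?A") if "\<phi> \<mu> \<in> \<Omega>0" for \<mu>
  proof
    assume "finite ?A"
    define Z where "Z = {\<nu>. \<phi> \<nu> r0 = \<phi> \<mu> r0}"
    have "infinite Z"
      using powser_order_half_takes_values_infinitely_often[of "\<lambda>n. a n r0" r0 "\<phi> \<mu> r0"]
        a_pos a_le \<open>r0 > 0\<close> by (simp add: Z_def \<phi>_r0 sol_def)
    \<comment> \<open>A parameter in \<open>Z\<close> whose eigenfunction lies in
      \<open>\<Omega>0\<close> must be \<open>\<mu>\<close>, so at most one function is lost.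
      Injectivity of \<open>\<phi>\<close> then carries infinitude from parameters to
      functions.\<close>
    moreover have "\<phi> ` Z \<subseteq> insert (\<phi> \<mu>) ?A"
      using determined[OF _ that] by (auto simp: Z_def)
    then have "finite (\<phi> ` Z)" using \<open>finite ?A\<close> finite_subset by auto
    then have "finite Z" using inj by (intro finite_imageD[of \<phi>]) (auto intro: inj_onI)
    ultimately show False by contradiction
  qed
  with determined show ?thesis by blast
qed

end
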